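(* Let $\alpha>0$, $\gamma\in\mathbb{R}$, $p>0$, $\beta\in\mathbb{R}$, and let $\mathcal{C}=A^{-\alpha}$ and $\mathcal{S}=A_S^{\gamma}$. Suppose that $X\in\dot H_A^{p}$ and that $X\notin\dot H_A^{\tilde p}$ for every $\tilde p>p$. Suppose the data are generated by $Y=\beta\,\mathcal{S}X+\epsilon$, i.e. $Y\sim\mathsf{N}(\beta\,\mathcal{S}X,\mathcal{C})$, while the candidate model is $Y\sim\hat\mu_\beta=\mathsf{N}(\beta X,\mathcal{C})$. Let $\hat\beta_n$ denote the maximum likelihood estimator of the regression coefficient under the candidate model based on the $n$ observations $Y_i=(Y,e_i)_{L_2(\mathcal{X},\nu_{\mathcal{X}})}$, $i=1,\dots,n$. Then, $\mathbb{P}$-a.s., $$\hat\beta_n\to\begin{cases}\beta & \text{if } p<\alpha \text{ and } \gamma=0,\\ 0 & \text{if } p<\alpha \text{ and } \gamma<0,\\ \operatorname{sign}(\beta)\,\infty & \text{if } (p<\alpha \text{ and } \gamma>0) \text{ or } (p\ge\alpha \text{ and } \gamma>p-\alpha),\\ \beta_\infty=(Y,X)_{\mathcal{C}}/\|X\|_{\mathcal{C}}^2 & \text{if } p\ge\alpha \text{ and } \gamma\le p-\alpha,\end{cases}$$ where $\beta_\infty$ is finite with $\mathsf{E}(\beta_\infty)=\beta(\mathcal{S}X,X)_{\mathcal{C}}/\|X\|_{\mathcal{C}}^2$. (The third case is the assertion of divergence to $+\infty$ if $\beta>0$ and to $-\infty$ if $\beta<0$.)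
   Context: $(\mathcal{X},d_{\mathcal{X}})$ is a connected, compact metric space of infinite cardinality, and $\nu_{\mathcal{X}}$ is a strictly positive and finite Borel measure on it. $L_2(\mathcal{X},\nu_{\mathcal{X}})$ is the Hilbert space of real-valued, Borel measurable, square-integrable functions. $\epsilon:\mathcal{X}\times\Omega\to\mathbb{R}$ is a square-integrable, centered Gaussian process on a complete probability space $(\Omega,\mathcal{A},\mathbb{P})$ with (strictly) positive definite covariance function $\varrho$. Its covariance operator $\mathcal{C}$ on $L_2(\mathcal{X},\nu_{\mathcal{X}})$ is $(\mathcal{C}w)(s)=\int_{\mathcal{X}}\varrho(s,s')w(s')\,d\nu_{\mathcal{X}}(s')$. $\mathsf{N}(f,\mathcal{C})$ denotes the law of $f+\epsilon$. $A:\mathcal{D}(A)\subsetneq L_2(\mathcal{X},\nu_{\mathcal{X}})\to L_2(\mathcal{X},\nu_{\mathcal{X}})$ is a densely defined, self-adjoint, positive linear operator with compact inverse, with eigenvectors $\{e_j\}_{j\in\mathbb{N}}$ (an orthonormal basis) and corresponding positive eigenvalues $\{\lambda_j\}$ in non-decreasing order, and there are constants $c,C,\eta>0$ with $c j^\eta\le\lambda_j\le C j^\eta$ for all $j\in\mathbb{N}$. Fractional powers are defined spectrally: $A^a f=\sum_j\lambda_j^a(f,e_j)_{L_2}e_j$. For $s>0$, $\dot H_A^{s}=\{f\in L_2(\mathcal{X},\nu_{\mathcal{X}}):\sum_j\lambda_j^{s}(f,e_j)_{L_2}^2<\infty\}$, and $\dot H_A^{-s}$ is its dual. $A_S$ is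 an operator diagonalized by the same eigenvectors $\{e_j\}$, with positive eigenvalues $\{\lambda_{S,j}\}$ satisfying $c_S j^\eta\le\lambda_{S,j}\le C_S j^\eta$ for all $j$ and some constants $c_S,C_S>0$; $A_S^\gamma f=\sum_j\lambda_{S,j}^\gamma(f,e_j)_{L_2}e_j$. When $\gamma>0$, $\mathcal{S}X$ may lie only in a dual space $\dot H_A^{-s}$, and the observations are understood coordinatewise via $(\mathcal{S}X,e_i)_{L_2}=\lambda_{S,i}^\gamma(X,e_i)_{L_2}$, so that $Y_i=\beta\lambda_{S,i}^\gamma(X,e_i)_{L_2}+(\epsilon,e_i)_{L_2}$, where the $(\epsilon,e_i)_{L_2}$ are independent $\mathsf{N}(0,\lambda_i^{-\alpha})$ variables. The inner product of the Cameron–Martin space $\mathcal{C}^{1/2}(L_2(\mathcal{X},\nu_{\mathcal{X}}))=\dot H_A^\alpha$ is $(f,g)_{\mathcal{C}}=(\mathcal{C}^{-1/2}f,\mathcal{C}^{-1/2}g)_{L_2}=\sum_i\lambda_i^\alpha(f,e_i)_{L_2}(g,e_i)_{L_2}$, with induced norm $\|\cdot\|_{\mathcal{C}}$. The expressions $(Y,X)_{\mathcal{C}}$ and $(\mathcal{S}X,X)_{\mathcal{C}}$ are understood as this series (an a.s. limit of partial sums in the case of $Y$), even when $Y$ or $\mathcal{S}X$ is not in the Cameron–Martin space. The maximum likelihood estimator $\hat\beta_n$ maximizes over $b\in\mathbb{R}$ the log-likelihood (up to constants) $-\frac12\sum_{i=1}^n\lambda_i^\alpha(Y_i-bX_i)^2$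 with $X_i=(X,e_i)_{L_2}$; i.e. $\hat\beta_n=\sum_{i=1}^n\lambda_i^\alpha Y_iX_i\big/\sum_{i=1}^n\lambda_i^\alpha X_i^2$ (defined once the denominator is nonzero). *)

theory Defs
  imports "HOL-Probability.Probability"
begin

section \<open>Square-integrable functions\<close>

text \<open>
  Elements of \<open>L\<^sub>2(X, \<nu>)\<close> are represented by functions; equality of elements is almost-everywhere
  equality, and convergence of elements is convergence in \<open>l2_norm\<close>.
\<close>

definition L2 :: "'x measure \<Rightarrow> ('x \<Rightarrow> real) set" where
  "L2 \<nu> = {f \<in> borel_measurable \<nu>. integrable \<nu> (\<lambda>x. (f x)\<^sup>2)}"

definition l2_inner :: "'x measure \<Rightarrow> ('x \<Rightarrow> real) \<Rightarrow> ('x \<Rightarrow> real) \<Rightarrow> real" where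
  "l2_inner \<nu> f g = (\<integral>x. f x * g x \<partial>\<nu>)"

definition l2_coeff :: "'x measure \<Rightarrow> (nat \<Rightarrow> 'x \<Rightarrow> real) \<Rightarrow> ('x \<Rightarrow> real) \<Rightarrow> nat \<Rightarrow> real" where
  "l2_coeff \<nu> e f j = l2_inner \<nu> f (e j)"

definition l2_norm :: "'x measure \<Rightarrow> ('x \<Rightarrow> real) \<Rightarrow> real" where
  "l2_norm \<nu> f = sqrt (l2_inner \<nu> f f)"

definition l2_eq :: "'x measure \<Rightarrow> ('x \<Rightarrow> real) \<Rightarrow> ('x \<Rightarrow> real) \<Rightarrow> bool" where
  "l2_eq \<nu> f g \<longleftrightarrow> (AE x in \<nu>. f x = g x)"

definition l2_sums :: "'x measure \<Rightarrow> (nat \<Rightarrow> 'x \<Rightarrow> real) \<Rightarrow> ('x \<Rightarrow> real) \<Rightarrow> bool" where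
  "l2_sums \<nu> F g \<longleftrightarrow> g \<in> L2 \<nu> \<and> (\<lambda>n. l2_norm \<nu> (\<lambda>x. (\<Sum>j<n. F j x) - g x)) \<longlonglongrightarrow> 0"

definition l2_orthonormal_basis :: "'x measure \<Rightarrow> (nat \<Rightarrow> 'x \<Rightarrow> real) \<Rightarrow> bool" where
  "l2_orthonormal_basis \<nu> e \<longleftrightarrow>
     (\<forall>j. e j \<in> L2 \<nu>) \<and>
     (\<forall>i j. l2_inner \<nu> (e i) (e j) = (if i = j then 1 else 0)) \<and>
     (\<forall>f\<in>L2 \<nu>. l2_sums \<nu> (\<lambda>j x. l2_coeff \<nu> e f j * e j x) f)"

section \<open>Unbounded operators\<close>

text \<open>
  An operator is given by its domain \<open>D\<close> and a function \<open>T\<close> whose values outside \<open>D\<close> are irrelevant.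
  Domain and operator have to respect almost-everywhere equality.
\<close>

definition l2_operator ::
  "'x measure \<Rightarrow> ('x \<Rightarrow> real) set \<Rightarrow> (('x \<Rightarrow> real) \<Rightarrow> ('x \<Rightarrow> real)) \<Rightarrow> bool" where
  "l2_operator \<nu> D T \<longleftrightarrow>
     D \<subseteq> L2 \<nu> \<and> (\<lambda>_. 0) \<in> D \<and>
     (\<forall>f\<in>D. T f \<in> L2 \<nu>) \<and>
     (\<forall>f\<in>D. \<forall>g\<in>D. \<forall>a b. (\<lambda>x. a * f x + b * g x) \<in> D \<and>
        l2_eq \<nu> (T (\<lambda>x. a * f x + b * g x)) (\<lambda>x. a * T f x + b * T g x)) \<and>
     (\<forall>f\<in>D. \<forall>g\<in>L2 \<nu>. l2_eq \<nu> f g \<longrightarrow> g \<in> D \<and> l2_eq \<nu> (T f) (T g))"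

definition densely_defined :: "'x measure \<Rightarrow> ('x \<Rightarrow> real) set \<Rightarrow> bool" where
  "densely_defined \<nu> D \<longleftrightarrow>
     (\<forall>f\<in>L2 \<nu>. \<forall>r>0. \<exists>g\<in>D. l2_norm \<nu> (\<lambda>x. f x - g x) < r)"

text \<open>The left-hand side of the equivalence says that \<open>(g, h)\<close> is in the graph of the adjoint.\<close>

definition self_adjoint ::
  "'x measure \<Rightarrow> ('x \<Rightarrow> real) set \<Rightarrow> (('x \<Rightarrow> real) \<Rightarrow> ('x \<Rightarrow> real)) \<Rightarrow> bool" where
  "self_adjoint \<nu> D T \<longleftrightarrow>
     (\<forall>g\<in>L2 \<nu>. \<forall>h\<in>L2 \<nu>.
        (\<forall>f\<in>D. l2_inner \<nu> (T f) g = l2_inner \<nu> f h) \<longleftrightarrow> (g \<in> D \<and> l2_eq \<nu> h (T g)))"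

definition positive_operator ::
  "'x measure \<Rightarrow> ('x \<Rightarrow> real) set \<Rightarrow> (('x \<Rightarrow> real) \<Rightarrow> ('x \<Rightarrow> real)) \<Rightarrow> bool" where
  "positive_operator \<nu> D T \<longleftrightarrow> (\<forall>f\<in>D. 0 \<le> l2_inner \<nu> (T f) f)"

definition l2_compact :: "'x measure \<Rightarrow> (('x \<Rightarrow> real) \<Rightarrow> ('x \<Rightarrow> real)) \<Rightarrow> bool" where
  "l2_compact \<nu> B \<longleftrightarrow>
     (\<forall>F. (\<forall>n::nat. F n \<in> L2 \<nu>) \<and> (\<exists>K. \<forall>n. l2_norm \<nu> (F n) \<le> K) \<longrightarrow>
        (\<exists>r::nat \<Rightarrow> nat. \<exists>g\<in>L2 \<nu>. strict_mono r \<and>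
           (\<lambda>n. l2_norm \<nu> (\<lambda>x. B (F (r n)) x - g x)) \<longlonglongrightarrow> 0))"

definition has_compact_inverse ::
  "'x measure \<Rightarrow> ('x \<Rightarrow> real) set \<Rightarrow> (('x \<Rightarrow> real) \<Rightarrow> ('x \<Rightarrow> real)) \<Rightarrow> bool" where
  "has_compact_inverse \<nu> D T \<longleftrightarrow>
     (\<exists>B. l2_operator \<nu> (L2 \<nu>) B \<and>
        (\<forall>f\<in>L2 \<nu>. B f \<in> D \<and> l2_eq \<nu> (T (B f)) f) \<and>
        (\<forall>f\<in>D. l2_eq \<nu> (B (T f)) f) \<and>
        l2_compact \<nu> B)"

definition diagonalized_by ::
  "'x measure \<Rightarrow> ('x \<Rightarrow> real) set \<Rightarrow> (('x \<Rightarrow> real) \<Rightarrow> ('x \<Rightarrow> real)) \<Rightarrow>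
     (nat \<Rightarrow> 'x \<Rightarrow> real) \<Rightarrow> (nat \<Rightarrow> real) \<Rightarrow> bool" where
  "diagonalized_by \<nu> D T e mu \<longleftrightarrow>
     D = {f \<in> L2 \<nu>. summable (\<lambda>j. (mu j)\<^sup>2 * (l2_coeff \<nu> e f j)\<^sup>2)} \<and>
     (\<forall>f\<in>D. l2_sums \<nu> (\<lambda>j x. mu j * l2_coeff \<nu> e f j * e j x) (T f))"

section \<open>Fractional powers and the associated smoothness spaces\<close>

text \<open>
  Coefficients of \<open>T\<^sup>a f\<close> with respect to \<open>e\<close>, where \<open>T\<close> has the eigenvalues \<open>mu\<close>. The coefficients
  make sense even if the series \<open>\<Sum>j. mu\<^sub>j\<^sup>a (f, e\<^sub>j) e\<^sub>j\<close> diverges in \<open>L\<^sub>2\<close>.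
\<close>

definition power_coeff ::
  "'x measure \<Rightarrow> (nat \<Rightarrow> 'x \<Rightarrow> real) \<Rightarrow> (nat \<Rightarrow> real) \<Rightarrow> real \<Rightarrow> ('x \<Rightarrow> real) \<Rightarrow> nat \<Rightarrow> real" where
  "power_coeff \<nu> e mu a f j = mu j powr a * l2_coeff \<nu> e f j"

definition is_power_image ::
  "'x measure \<Rightarrow> (nat \<Rightarrow> 'x \<Rightarrow> real) \<Rightarrow> (nat \<Rightarrow> real) \<Rightarrow> real \<Rightarrow> ('x \<Rightarrow> real) \<Rightarrow> ('x \<Rightarrow> real) \<Rightarrow> bool" where
  "is_power_image \<nu> e mu a f g \<longleftrightarrow> l2_sums \<nu> (\<lambda>j x. power_coeff \<nu> e mu a f j * e j x) g"

definition Hdot ::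
  "'x measure \<Rightarrow> (nat \<Rightarrow> 'x \<Rightarrow> real) \<Rightarrow> (nat \<Rightarrow> real) \<Rightarrow> real \<Rightarrow> ('x \<Rightarrow> real) set" where
  "Hdot \<nu> e lam s = {f \<in> L2 \<nu>. summable (\<lambda>j. lam j powr s * (l2_coeff \<nu> e f j)\<^sup>2)}"

section \<open>Gaussian processes\<close>

definition gaussian_rv :: "'w measure \<Rightarrow> ('w \<Rightarrow> real) \<Rightarrow> bool" where
  "gaussian_rv P Z \<longleftrightarrow> Z \<in> borel_measurable P \<and>
     ((\<exists>m. AE w in P. Z w = m) \<or>
      (\<exists>m \<sigma>. 0 < \<sigma> \<and> distributed P lborel Z (normal_density m \<sigma>)))"

definition gaussian_process :: "'w measure \<Rightarrow> ('x \<Rightarrow> 'w \<Rightarrow> real) \<Rightarrow> bool" where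
  "gaussian_process P Z \<longleftrightarrow>
     (\<forall>S a. finite S \<longrightarrow> gaussian_rv P (\<lambda>w. \<Sum>s\<in>S. a s * Z s w))"

definition covariance_fun :: "'w measure \<Rightarrow> ('x \<Rightarrow> 'w \<Rightarrow> real) \<Rightarrow> 'x \<Rightarrow> 'x \<Rightarrow> real" where
  "covariance_fun P Z s t =
     (\<integral>w. (Z s w - (\<integral>v. Z s v \<partial>P)) * (Z t w - (\<integral>v. Z t v \<partial>P)) \<partial>P)"

definition strictly_positive_definite :: "('x \<Rightarrow> 'x \<Rightarrow> real) \<Rightarrow> bool" where
  "strictly_positive_definite k \<longleftrightarrow>
     (\<forall>s t. k s t = k t s) \<and>
     (\<forall>S a. finite S \<and> (\<exists>s\<in>S. a s \<noteq> 0) \<longrightarrow> 0 < (\<Sum>s\<in>S. \<Sum>t\<in>S. a s * a t * k s t))"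

definition covariance_op ::
  "'x measure \<Rightarrow> ('x \<Rightarrow> 'x \<Rightarrow> real) \<Rightarrow> ('x \<Rightarrow> real) \<Rightarrow> 'x \<Rightarrow> real" where
  "covariance_op \<nu> k w s = (\<integral>t. k s t * w t \<partial>\<nu>)"

section \<open>The Cameron-Martin inner product on coefficient sequences\<close>

text \<open>
  The arguments are coefficient sequences, so that the pairing also applies to objects outside the
  Cameron-Martin space. The value is meaningful only if the partial sums converge, which is
  \<open>cm_summable\<close>.
\<close>

definition cm_summable :: "(nat \<Rightarrow> real) \<Rightarrow> real \<Rightarrow> (nat \<Rightarrow> real) \<Rightarrow> (nat \<Rightarrow> real) \<Rightarrow> bool" where
  "cm_summable lam \<alpha> u v \<longleftrightarrow> summable (\<lambda>i. lam i powr \<alpha> * u i * v i)"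

definition cm_inner :: "(nat \<Rightarrow> real) \<Rightarrow> real \<Rightarrow> (nat \<Rightarrow> real) \<Rightarrow> (nat \<Rightarrow> real) \<Rightarrow> real" where
  "cm_inner lam \<alpha> u v = (\<Sum>i. lam i powr \<alpha> * u i * v i)"

definition cm_norm :: "(nat \<Rightarrow> real) \<Rightarrow> real \<Rightarrow> (nat \<Rightarrow> real) \<Rightarrow> real" where
  "cm_norm lam \<alpha> u = sqrt (cm_inner lam \<alpha> u u)"

section \<open>Maximum likelihood in the candidate model\<close>

text \<open>
  Under \<open>N(b X, A\<^sup>-\<^sup>\<alpha>)\<close> the coordinates \<open>Y\<^sub>i\<close> are independent normal variables with mean \<open>b X\<^sub>i\<close> and
  variance \<open>lam\<^sub>i\<^sup>-\<^sup>\<alpha>\<close>. Below, \<open>x\<close> and \<open>y\<close> are the coefficient sequences of \<open>X\<close> and \<open>Y\<close>.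
\<close>

definition log_likelihood ::
  "(nat \<Rightarrow> real) \<Rightarrow> real \<Rightarrow> (nat \<Rightarrow> real) \<Rightarrow> (nat \<Rightarrow> real) \<Rightarrow> nat \<Rightarrow> real \<Rightarrow> real" where
  "log_likelihood lam \<alpha> x y n b =
     (\<Sum>i<n. ln (normal_density (b * x i) (sqrt (lam i powr (-\<alpha>))) (y i)))"

lemma log_likelihood_eq:
  assumes "\<And>i. 0 < lam i"
  shows "\<exists>K. \<forall>b. log_likelihood lam \<alpha> x y n b =
           K - 1/2 * (\<Sum>i<n. lam i powr \<alpha> * (y i - b * x i)\<^sup>2)"
proof (intro exI allI)
  fix b
  have "ln (normal_density (b * x i) (sqrt (lam i powr (-\<alpha>))) (y i)) =
          ln (1 / sqrt (2 * pi * lam i powr (-\<alpha>))) - 1/2 * (lam i powr \<alpha> * (y i - b * x i)\<^sup>2)" for i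
  proof -
    have p: "0 < lam i powr (-\<alpha>)" using assms[of i] by simp
    have "ln (normal_density (b * x i) (sqrt (lam i powr (-\<alpha>))) (y i)) =
          ln (1 / sqrt (2 * pi * lam i powr (-\<alpha>))) + - (y i - b * x i)\<^sup>2 / (2 * lam i powr (-\<alpha>))"
      using p unfolding normal_density_def by (subst ln_mult) auto
    also have "- (y i - b * x i)\<^sup>2 / (2 * lam i powr (-\<alpha>)) =
               - (1/2 * (lam i powr \<alpha> * (y i - b * x i)\<^sup>2))"
      using p by (simp add: powr_minus field_simps)
    finally show ?thesis by simp
  qed
  then show "log_likelihood lam \<alpha> x y n b =
      (\<Sum>i<n. ln (1 / sqrt (2 * pi * lam i powr (-\<alpha>)))) -
      1/2 * (\<Sum>i<n. lam i powr \<alpha> * (y i - b * x i)\<^sup>2)"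
    unfolding log_likelihood_def by (simp add: sum_subtractf sum_distrib_left)
qed

text \<open>
  The maximizer is unique as soon as \<open>x\<^sub>i \<noteq> 0\<close> for some \<open>i < n\<close>; otherwise the likelihood is constant
  and the value is arbitrary.
\<close>

definition mle ::
  "(nat \<Rightarrow> real) \<Rightarrow> real \<Rightarrow> (nat \<Rightarrow> real) \<Rightarrow> (nat \<Rightarrow> real) \<Rightarrow> nat \<Rightarrow> real" where
  "mle lam \<alpha> x y n = (ARG_MAX (log_likelihood lam \<alpha> x y n) b. True)"

lemma mle_eq:
  assumes pos: "\<And>i. 0 < lam i" and nz: "(\<Sum>i<n. lam i powr \<alpha> * (x i)\<^sup>2) \<noteq> 0"
  shows "mle lam \<alpha> x y n =
           (\<Sum>i<n. lam i powr \<alpha> * y i * x i) / (\<Sum>i<n. lam i powr \<alpha> * (x i)\<^sup>2)"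
proof -
  define N where "N = (\<Sum>i<n. lam i powr \<alpha> * y i * x i)"
  define Q where "Q = (\<Sum>i<n. lam i powr \<alpha> * (x i)\<^sup>2)"
  define R where "R = (\<Sum>i<n. lam i powr \<alpha> * (y i)\<^sup>2)"
  have "0 \<le> Q" unfolding Q_def by (intro sum_nonneg) simp
  with nz have Q: "0 < Q" by (simp add: Q_def)
  obtain K where K: "\<And>b. log_likelihood lam \<alpha> x y n b =
      K - 1/2 * (\<Sum>i<n. lam i powr \<alpha> * (y i - b * x i)\<^sup>2)"
    using log_likelihood_eq[of lam \<alpha> x y n, OF pos] by blast
  have "(\<Sum>i<n. lam i powr \<alpha> * (y i - b * x i)\<^sup>2) = R - 2 * b * N + b\<^sup>2 * Q" for b
    unfolding R_def N_def Q_def sum_distrib_left sum.distrib[symmetric] sum_subtractf[symmetric]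
    by (intro sum.cong) (auto simp: power2_eq_square algebra_simps)
  also have "R - 2 * b * N + b\<^sup>2 * Q = R - N\<^sup>2 / Q + Q * (b - N / Q)\<^sup>2" for b
    using Q by (simp add: power2_eq_square field_simps)
  finally have eq: "log_likelihood lam \<alpha> x y n b =
      K - 1/2 * (R - N\<^sup>2 / Q + Q * (b - N / Q)\<^sup>2)" for b
    by (simp add: K)
  let ?f = "log_likelihood lam \<alpha> x y n"
  have "is_arg_max ?f (\<lambda>_. True) (N / Q)"
    unfolding is_arg_max_linorder using Q by (simp add: eq)
  then have "is_arg_max ?f (\<lambda>_. True) (mle lam \<alpha> x y n)"
    unfolding mle_def arg_max_def by (rule someI)
  then have "?f (N / Q) \<le> ?f (mle lam \<alpha> x y n)"
    unfolding is_arg_max_linorder by blast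
  then have "Q * (mle lam \<alpha> x y n - N / Q)\<^sup>2 \<le> 0" by (simp add: eq)
  with Q have "mle lam \<alpha> x y n = N / Q"
    by (simp add: mult_le_0_iff)
  then show ?thesis by (simp add: N_def Q_def)
qed

end

theory Submission
  imports Defs
begin

text \<open>
  With \<open>x\<^sub>i = (X, e\<^sub>i)\<close>, \<open>\<xi>\<^sub>i = (\<epsilon>, e\<^sub>i)\<close>, \<open>w\<^sub>i = \<lambda>\<^sub>i\<^sup>\<alpha> x\<^sub>i\<^sup>2\<close> and \<open>s\<^sub>i = \<lambda>\<^sub>S\<^sub>,\<^sub>i\<^sup>\<gamma>\<close>, the estimator is \<open>\<beta>\<close> times the
  \<open>w\<close>-weighted average of the \<open>s\<^sub>i\<close>, plus the noise sum \<open>\<Sum>\<lambda>\<^sub>i\<^sup>\<alpha> x\<^sub>i \<xi>\<^sub>i\<close> divided by \<open>\<Sum>w\<^sub>i\<close>. The weights are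
  summable iff \<open>\<alpha> \<le> p\<close>, and the \<open>w\<^sub>i s\<^sub>i\<close> iff \<open>\<gamma> \<le> p - \<alpha>\<close>, which settles the first part in every case.

  The noise sum has orthogonal terms, and the variance of a block of terms is the sum of its \<open>w\<^sub>i\<close>. Neither
  independence of the \<open>\<xi>\<^sub>i\<close> nor their joint law is needed: \<open>\<integral>\<epsilon> g d\<nu>\<close> is an \<open>L\<^sub>2(P)\<close>-limit of finite
  combinations of the \<open>\<epsilon>(s)\<close>, so by Fatou's lemma its fourth moment is at most three times the square of its
  second moment. This bound is quadratic in the variance, so a bisection argument controls the fourth moment of
  the maximal partial sum without logarithmic loss. Hence the noise series converges almost surely if the
  weights are summable, and otherwise Kronecker's lemma makes the normalised noise vanish.
\<close>

section \<open>Weighted averages and series of reals\<close>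

text \<open>Toeplitz averaging: the terms before \<open>n0\<close> contribute the fixed error
  \<open>H\<close>, which the diverging total weight swamps, while every later \<open>t i\<close> is
  within \<open>r / 2\<close> of \<open>L\<close>.\<close>

lemma weighted_average_tendsto:
  fixes w t :: "nat \<Rightarrow> real"
  assumes w: "\<And>i. 0 \<le> w i"
    and W: "filterlim (\<lambda>n. \<Sum>i<n. w i) at_top sequentially"
    and t: "t \<longlonglongrightarrow> L"
  shows "(\<lambda>n. (\<Sum>i<n. w i * t i) / (\<Sum>i<n. w i)) \<longlonglongrightarrow> L"
proof (rule LIMSEQ_I)
  fix r :: real assume r: "0 < r"
  then have "0 < r / 2" by simp
  from LIMSEQ_D[OF t this] obtain n0 where n0: "\<And>n. n \<ge> n0 \<Longrightarrow> \<bar>t n - L\<bar> < r / 2"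
    by auto
  define H where "H = (\<Sum>i<n0. w i * \<bar>t i - L\<bar>)"
  have H: "0 \<le> H" unfolding H_def by (intro sum_nonneg) (simp add: w)
  \<comment> \<open>The added 1 makes \<open>H\<close> strictly smaller than \<open>r / 2\<close>
    times the total weight and keeps that weight positive even when \<open>H\<close> is 0.\<close>
  have "eventually (\<lambda>n. 2 * H / r + 1 \<le> (\<Sum>i<n. w i)) sequentially"
    using W by (simp add: filterlim_at_top)
  then obtain n1 where n1: "\<And>n. n \<ge> n1 \<Longrightarrow> 2 * H / r + 1 \<le> (\<Sum>i<n. w i)"
    by (auto simp: eventually_sequentially)
  show "\<exists>no. \<forall>n\<ge>no. norm ((\<Sum>i<n. w i * t i) / (\<Sum>i<n. w i) - L) < r"
  proof (intro exI[of _ "max n0 n1"] allI impI)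
    fix n assume n: "max n0 n1 \<le> n"
    let ?W = "\<Sum>i<n. w i"
    have big: "2 * H / r + 1 \<le> ?W" using n1 n by simp
    have "0 \<le> 2 * H / r" using H r by simp
    with big have Wp: "0 < ?W" by simp
    have "2 * H + r \<le> r * ?W" using big r by (simp add: field_simps)
    then have small: "H < r / 2 * ?W" using r by (simp add: field_simps)
    have "\<bar>(\<Sum>i<n. w i * t i) - L * ?W\<bar> = \<bar>\<Sum>i<n. w i * (t i - L)\<bar>"
      by (simp add: sum_distrib_left sum_subtractf algebra_simps)
    also have "\<dots> \<le> (\<Sum>i<n. w i * \<bar>t i - L\<bar>)"
      by (rule order_trans[OF sum_abs]) (simp add: abs_mult w)
    also have "\<dots> = H + (\<Sum>i=n0..<n. w i * \<bar>t i - L\<bar>)"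
      using n unfolding H_def lessThan_atLeast0 by (subst sum.atLeastLessThan_concat) auto
    also have "(\<Sum>i=n0..<n. w i * \<bar>t i - L\<bar>) \<le> (\<Sum>i=n0..<n. w i * (r / 2))"
      using n0 by (intro sum_mono mult_left_mono w less_imp_le) auto
    also have "\<dots> \<le> (\<Sum>i<n. w i * (r / 2))"
      using r w by (intro sum_mono2) auto
    also have "\<dots> = r / 2 * ?W" by (simp add: sum_distrib_left algebra_simps)
    finally have "\<bar>(\<Sum>i<n. w i * t i) - L * ?W\<bar> < r * ?W"
      using small by simp
    moreover have "(\<Sum>i<n. w i * t i) / ?W - L = ((\<Sum>i<n. w i * t i) - L * ?W) / ?W"
      using Wp by (simp add: field_simps)
    ultimately show "norm ((\<Sum>i<n. w i * t i) / ?W - L) < r"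
      using Wp by (simp add: abs_divide field_simps)
  qed
qed

text \<open>Truncating \<open>t\<close> at \<open>\<bar>Z\<bar> + 1\<close> reduces this to a finite
  limit: the truncated averages tend to a value above \<open>Z\<close> and lie below the original
  ones.\<close>

lemma weighted_average_at_top:
  fixes w t :: "nat \<Rightarrow> real"
  assumes w: "\<And>i. 0 \<le> w i" and t_nonneg: "\<And>i. 0 \<le> t i"
    and W: "filterlim (\<lambda>n. \<Sum>i<n. w i) at_top sequentially"
    and t: "filterlim t at_top sequentially"
  shows "filterlim (\<lambda>n. (\<Sum>i<n. w i * t i) / (\<Sum>i<n. w i)) at_top sequentially"
  unfolding filterlim_at_top
proof
  fix Z :: real
  have "eventually (\<lambda>i. \<bar>Z\<bar> + 1 \<le> t i) sequentially"
    using t by (simp add: filterlim_at_top)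
  then have "(\<lambda>i. min (t i) (\<bar>Z\<bar> + 1)) \<longlonglongrightarrow> \<bar>Z\<bar> + 1"
    by (intro tendsto_eventually) (auto elim: eventually_mono)
  from order_tendstoD(1)[OF weighted_average_tendsto[OF w W this], of Z]
  have "eventually (\<lambda>n. Z < (\<Sum>i<n. w i * min (t i) (\<bar>Z\<bar> + 1)) / (\<Sum>i<n. w i)) sequentially"
    by simp
  then show "eventually (\<lambda>n. Z \<le> (\<Sum>i<n. w i * t i) / (\<Sum>i<n. w i)) sequentially"
  proof eventually_elim
    case (elim n)
    have "(\<Sum>i<n. w i * min (t i) (\<bar>Z\<bar> + 1)) / (\<Sum>i<n. w i) \<le> (\<Sum>i<n. w i * t i) / (\<Sum>i<n. w i)"
      by (intro divide_right_mono sum_mono mult_left_mono sum_nonneg w) auto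
    with elim show ?case by simp
  qed
qed

text \<open>Kronecker's lemma by summation by parts: up to the factor
  \<open>inverse (S n) + 1\<close>, the quotient is \<open>T n\<close> minus a weighted average of
  the earlier \<open>T i\<close>, and both have the same limit. The summand 1 in the normaliser
  keeps it positive when initial weights vanish.\<close>

lemma kronecker_normalised_sums:
  fixes w y :: "nat \<Rightarrow> real"
  assumes w: "\<And>i. 0 \<le> w i"
    and W: "filterlim (\<lambda>n. \<Sum>i<n. w i) at_top sequentially"
    and y: "summable (\<lambda>i. y i / (1 + (\<Sum>j<Suc i. w j)))"
  shows "(\<lambda>n. (\<Sum>i<n. y i) / (\<Sum>i<n. w i)) \<longlonglongrightarrow> 0"
proof -
  define S where "S n = (\<Sum>i<n. w i)" for n
  define T where "T n = (\<Sum>i<n. y i / (1 + S (Suc i)))" for n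
  have pos: "0 < 1 + S n" for n
    using sum_nonneg[of "{..<n}" w] w by (simp add: S_def add_pos_nonneg)
  have parts: "(\<Sum>i<n. y i) = (1 + S n) * T n - (\<Sum>i<n. w i * T i)" for n
  proof (induction n)
    case 0 then show ?case by (simp add: T_def)
  next
    case (Suc n)
    have "T (Suc n) = T n + y n / (1 + S (Suc n))" by (simp add: T_def)
    then have "(1 + S (Suc n)) * T (Suc n) = (1 + S (Suc n)) * T n + y n"
      using pos[of "Suc n"] by (simp add: distrib_left)
    moreover have "S (Suc n) = S n + w n" by (simp add: S_def)
    ultimately show ?case using Suc by (simp add: algebra_simps)
  qed
  obtain L where L: "T \<longlonglongrightarrow> L"
    using y unfolding T_def S_def summable_iff_convergent convergent_def by blast
  have W': "filterlim S at_top sequentially" using W by (simp add: S_def[abs_def])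
  have "(\<lambda>n. (\<Sum>i<n. w i * T i) / S n) \<longlonglongrightarrow> L"
    unfolding S_def by (rule weighted_average_tendsto[OF w W L])
  moreover have "(\<lambda>n. inverse (S n)) \<longlonglongrightarrow> 0"
    using W' by (rule tendsto_inverse_0_at_top)
  ultimately have "(\<lambda>n. (inverse (S n) + 1) * T n - (\<Sum>i<n. w i * T i) / S n) \<longlonglongrightarrow> (0 + 1) * L - L"
    by (intro tendsto_intros L)
  moreover have "eventually (\<lambda>n. 0 < S n) sequentially"
    using W' by (simp add: filterlim_at_top_dense)
  then have "eventually (\<lambda>n. (inverse (S n) + 1) * T n - (\<Sum>i<n. w i * T i) / S n
      = (\<Sum>i<n. y i) / S n) sequentially"
    by eventually_elim (simp add: parts field_simps)
  ultimately show ?thesis unfolding S_def by (simp add: tendsto_cong)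
qed

text \<open>Each term is dominated by a telescoping difference
  \<open>1 / S i - 1 / S (Suc i)\<close>. This gives the normalised noise summable
  variances.\<close>

lemma summable_normalised_squares:
  fixes w :: "nat \<Rightarrow> real"
  assumes w: "\<And>i. 0 \<le> w i"
  shows "summable (\<lambda>i. w i / (1 + (\<Sum>j<Suc i. w j))\<^sup>2)"
proof (rule summableI_nonneg_bounded[where x=1])
  define S where "S n = 1 + (\<Sum>i<n. w i)" for n
  have pos: "0 < S n" for n
    using sum_nonneg[of "{..<n}" w] w by (simp add: S_def add_pos_nonneg)
  fix n
  show "0 \<le> w n / (1 + (\<Sum>j<Suc n. w j))\<^sup>2" using w by simp
  have step: "w i / (S (Suc i))\<^sup>2 \<le> 1 / S i - 1 / S (Suc i)" for i
  proof -
    have S: "S (Suc i) = S i + w i" by (simp add: S_def)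
    have "w i / (S (Suc i))\<^sup>2 \<le> w i / (S i * S (Suc i))"
      using w[of i] pos[of i] pos[of "Suc i"] unfolding S power2_eq_square
      by (intro divide_left_mono mult_right_mono) auto
    also have "\<dots> = 1 / S i - 1 / S (Suc i)"
      using pos[of i] pos[of "Suc i"] S by (simp add: field_simps)
    finally show ?thesis .
  qed
  have "(\<Sum>i<n. w i / (S (Suc i))\<^sup>2) \<le> (\<Sum>i<n. 1 / S i - 1 / S (Suc i))"
    by (intro sum_mono step)
  also have "\<dots> = 1 / S 0 - 1 / S n" by (rule sum_lessThan_telescope')
  also have "\<dots> \<le> 1" using pos[of n] by (simp add: S_def)
  finally show "(\<Sum>i<n. w i / (1 + (\<Sum>j<Suc i. w j))\<^sup>2) \<le> 1" by (simp add: S_def)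
qed

lemma sum_at_top_if_not_summable:
  fixes w :: "nat \<Rightarrow> real"
  assumes w: "\<And>i. 0 \<le> w i" and "\<not> summable w"
  shows "filterlim (\<lambda>n. \<Sum>i<n. w i) at_top sequentially"
  unfolding filterlim_at_top eventually_sequentially
proof (intro allI)
  fix Z :: real
  obtain N where N: "Z < (\<Sum>i<N. w i)"
    using summableI_nonneg_bounded[of w Z] assms by (meson not_less)
  have "Z \<le> (\<Sum>i<n. w i)" if "N \<le> n" for n
    using N sum_mono2[of "{..<n}" "{..<N}" w] w that by auto
  then show "\<exists>N. \<forall>n\<ge>N. Z \<le> (\<Sum>i<n. w i)" by blast
qed

section \<open>Powers of divergent and of comparable sequences\<close>

lemma powr_at_top_pos:
  fixes f :: "nat \<Rightarrow> real"
  assumes a: "0 < a" and f: "filterlim f at_top sequentially"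
  shows "filterlim (\<lambda>i. f i powr a) at_top sequentially"
proof -
  have "(\<lambda>i. f i powr (- a)) \<longlonglongrightarrow> 0"
    using a f by (intro tendsto_neg_powr) auto
  moreover have "eventually (\<lambda>i. 0 < f i powr (- a)) sequentially"
    using f[THEN filterlim_at_top_dense[THEN iffD1], rule_format, of 0] by eventually_elim simp
  ultimately have "filterlim (\<lambda>i. inverse (f i powr (- a))) at_top sequentially"
    by (rule filterlim_inverse_at_top)
  then show ?thesis by (simp add: powr_minus)
qed

text \<open>For a nonnegative exponent the upper bound on \<open>m\<close> decides, for a negative
  one the lower bound; adding the two constants gives one estimate for both signs.\<close>

lemma powr_comparable:
  fixes l m :: real
  assumes "0 < l" "0 < k1" "0 < k2" "k1 * l \<le> m" "m \<le> k2 * l"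
  shows "m powr a \<le> (k1 powr a + k2 powr a) * l powr a"
proof (cases "0 \<le> a")
  case True
  have "0 < k1 * l" using assms by simp
  with assms(4) have "0 \<le> m" by linarith
  with True assms(5) have "m powr a \<le> (k2 * l) powr a"
    by (intro powr_mono2)
  then show ?thesis using assms by (simp add: powr_mult distrib_right add_increasing add_increasing2)
next
  case False
  then have "m powr a \<le> (k1 * l) powr a"
    using assms by (intro powr_mono2') auto
  then show ?thesis using assms by (simp add: powr_mult distrib_right add_increasing add_increasing2)
qed

lemma summable_le_mult:
  fixes f g :: "nat \<Rightarrow> real"
  assumes "\<And>i. 0 \<le> f i" "\<And>i. f i \<le> k * g i" and g: "summable g"
  shows "summable f"
proof (rule summable_comparison_test')
  show "summable (\<lambda>i. k * g i)" using g by (rule summable_mult)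
qed (use assms in simp)

text \<open>As \<open>lam\<close> is bounded away from 0, the nonpositive power
  \<open>lam i powr (q - p)\<close> is at most \<open>c powr (q - p)\<close>.\<close>

lemma summable_powr_le_exponent:
  fixes lam x :: "nat \<Rightarrow> real"
  assumes c: "0 < c" "\<And>i. c \<le> lam i" and q: "q \<le> p"
    and s: "summable (\<lambda>i. lam i powr p * (x i)\<^sup>2)"
  shows "summable (\<lambda>i. lam i powr q * (x i)\<^sup>2)"
proof (rule summable_le_mult[OF _ _ s])
  fix i
  have "lam i powr q = lam i powr (q - p) * lam i powr p"
    by (simp add: powr_add[symmetric])
  also have "\<dots> \<le> c powr (q - p) * lam i powr p"
    using c q by (intro mult_right_mono powr_mono2') auto
  finally have "lam i powr q * (x i)\<^sup>2 \<le> c powr (q - p) * lam i powr p * (x i)\<^sup>2"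
    by (rule mult_right_mono) simp
  then show "lam i powr q * (x i)\<^sup>2 \<le> c powr (q - p) * (lam i powr p * (x i)\<^sup>2)"
    by (simp only: mult.assoc)
qed simp

section \<open>Series with controlled fourth moments\<close>

text \<open>The coefficient of \<open>y^4\<close> must stay below 2 so that the bisection below
  contracts; the one of \<open>x^4\<close> may be large. Comparing \<open>10 * \<bar>x\<bar>\<close>
  with \<open>\<bar>y\<bar>\<close> gives \<open>(11/10)^4 < 3/2\<close> in one case and
  \<open>11^4 = 14641\<close> in the other.\<close>

lemma fourth_power_add_le:
  fixes x y :: real
  shows "(x + y)^4 \<le> 3/2 * y^4 + 14641 * x^4"
proof (cases "10 * \<bar>x\<bar> \<le> \<bar>y\<bar>")
  case True
  then have "\<bar>x + y\<bar> \<le> 11/10 * \<bar>y\<bar>" by linarith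
  then have "\<bar>x + y\<bar>^4 \<le> (11/10 * \<bar>y\<bar>)^4" by (intro power_mono) auto
  then have "(x + y)^4 \<le> (11/10 * \<bar>y\<bar>)^4" by simp
  also have "\<dots> \<le> 3/2 * y^4" by (simp add: power_mult_distrib power_divide)
  also have "\<dots> \<le> 3/2 * y^4 + 14641 * x^4" by simp
  finally show ?thesis .
next
  case False
  then have "\<bar>x + y\<bar> \<le> 11 * \<bar>x\<bar>" by linarith
  then have "\<bar>x + y\<bar>^4 \<le> (11 * \<bar>x\<bar>)^4" by (intro power_mono) auto
  then have "(x + y)^4 \<le> (11 * \<bar>x\<bar>)^4" by simp
  also have "\<dots> = 14641 * x^4" by (simp add: power_mult_distrib)
  also have "\<dots> \<le> 3/2 * y^4 + 14641 * x^4" by simp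
  finally show ?thesis .
qed

text \<open>The cut \<open>h\<close> is the last index whose preceding weight is at most half. Its
  own weight is left out of both halves, since a single weight may exceed half of the total.\<close>

lemma exists_balanced_cut:
  fixes v :: "nat \<Rightarrow> real"
  assumes v: "\<And>i. 0 \<le> v i" and "m < n"
  obtains h where "m \<le> h" "h < n"
    "(\<Sum>i=m..<h. v i) \<le> (\<Sum>i=m..<n. v i) / 2" "(\<Sum>i=Suc h..<n. v i) \<le> (\<Sum>i=m..<n. v i) / 2"
proof -
  define u where "u = (\<Sum>i=m..<n. v i)"
  have u: "0 \<le> u" unfolding u_def by (intro sum_nonneg v)
  define H where "H = {h. m \<le> h \<and> h < n \<and> (\<Sum>i=m..<h. v i) \<le> u / 2}"
  have fin: "finite H" unfolding H_def by (rule finite_subset[of _ "{..<n}"]) auto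
  have "m \<in> H" using assms u by (simp add: H_def)
  then have hH: "Max H \<in> H" using fin by (intro Max_in) auto
  define h where "h = Max H"
  have h: "m \<le> h" "h < n" "(\<Sum>i=m..<h. v i) \<le> u / 2"
    using hH by (auto simp: H_def h_def)
  have "(\<Sum>i=Suc h..<n. v i) \<le> u / 2"
  proof (cases "Suc h < n")
    case True
    have "Suc h \<notin> H" using Max_ge[OF fin, of "Suc h"] by (auto simp: h_def)
    then have "u / 2 < (\<Sum>i=m..<Suc h. v i)" using True h unfolding H_def by auto
    moreover have "u = (\<Sum>i=m..<Suc h. v i) + (\<Sum>i=Suc h..<n. v i)"
      unfolding u_def using h by (subst sum.atLeastLessThan_concat) auto
    ultimately show ?thesis by simp
  qed (use u in simp)
  with h that show ?thesis by (simp add: u_def)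
qed

text \<open>Induction on the block length along a balanced cut. Each half carries at most half the
  weight, hence a quarter of the quadratic bound, so two halves with factor 3/2 contribute 3/4 of
  it. The constant \<open>58564 = 4 * 14641\<close> solves
  \<open>3/4 * z + 14641 = z\<close>.\<close>

lemma fourth_moment_maximal_inequality:
  fixes Z :: "nat \<Rightarrow> 'a \<Rightarrow> real" and v :: "nat \<Rightarrow> real"
  assumes Z[measurable]: "\<And>i. Z i \<in> borel_measurable M" and v: "\<And>i. 0 \<le> v i" and K: "0 \<le> K"
    and moment: "\<And>m n. (\<integral>\<^sup>+w. ennreal ((\<Sum>i=m..<n. Z i w)^4) \<partial>M) \<le> ennreal (K * (\<Sum>i=m..<n. v i)\<^sup>2)"
  shows "(\<integral>\<^sup>+w. (SUP k\<in>{m..n}. ennreal ((\<Sum>i=m..<k. Z i w)^4)) \<partial>M)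
    \<le> ennreal (58564 * K * (\<Sum>i=m..<n. v i)\<^sup>2)"
proof (induction "n - m" arbitrary: m n rule: less_induct)
  case less
  show ?case
  proof (cases "m < n")
    case False
    then have "(SUP k\<in>{m..n}. ennreal ((\<Sum>i=m..<k. Z i w)^4)) = 0" for w
      by (auto simp: SUP_eq_const not_less le_less bot_ennreal)
    then show ?thesis by simp
  next
    case True
    define u where "u = (\<Sum>i=m..<n. v i)"
    define D where "D m n w = (SUP k\<in>{m..n}. ennreal ((\<Sum>i=m..<k. Z i w)^4))" for m n w
    have [measurable]: "D m n \<in> borel_measurable M" for m n
      unfolding D_def by measurable
    obtain h where h: "m \<le> h" "h < n" "(\<Sum>i=m..<h. v i) \<le> u / 2" "(\<Sum>i=Suc h..<n. v i) \<le> u / 2"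
      using exists_balanced_cut[of v, OF v True, folded u_def] .
    have half: "ennreal (58564 * K * s\<^sup>2) \<le> ennreal (14641 * K * u\<^sup>2)" if "0 \<le> s" "s \<le> u / 2" for s
    proof -
      have "s\<^sup>2 \<le> (u / 2)\<^sup>2" using that by (intro power_mono) auto
      from mult_left_mono[OF this K] show ?thesis
        by (intro ennreal_leI) (simp add: power_divide)
    qed
    have 1: "(\<integral>\<^sup>+w. D m h w \<partial>M) \<le> ennreal (14641 * K * u\<^sup>2)"
      unfolding D_def
      by (rule order_trans[OF less half[OF _ h(3)]]) (use h v in \<open>auto intro: sum_nonneg\<close>)
    have 2: "(\<integral>\<^sup>+w. D (Suc h) n w \<partial>M) \<le> ennreal (14641 * K * u\<^sup>2)"
      unfolding D_def
      by (rule order_trans[OF less half[OF _ h(4)]]) (use h v in \<open>auto intro: sum_nonneg\<close>)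
    have "(\<Sum>i=m..<Suc h. v i) \<le> u"
      unfolding u_def using h v by (intro sum_mono2) auto
    then have "(\<Sum>i=m..<Suc h. v i)\<^sup>2 \<le> u\<^sup>2"
      using v by (intro power_mono) (auto intro: sum_nonneg simp del: sum.op_ivl_Suc)
    from mult_left_mono[OF this K]
    have 3: "(\<integral>\<^sup>+w. ennreal ((\<Sum>i=m..<Suc h. Z i w)^4) \<partial>M) \<le> ennreal (K * u\<^sup>2)"
      by (intro order_trans[OF moment] ennreal_leI)
    have lin: "ennreal (3/2 * a + 14641 * b) = ennreal (3/2) * ennreal a + ennreal 14641 * ennreal b"
      if "0 \<le> a" "0 \<le> b" for a b :: real
      using that ennreal_mult[of "3/2" a] ennreal_mult[of 14641 b] ennreal_plus[of "3/2 * a" "14641 * b"]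
      by simp
    \<comment> \<open>Up to \<open>h\<close> the maximum of the left half suffices. Beyond it, the
      sum splits into the block through \<open>h\<close>, which is estimated by
      \<open>moment\<close> without recursion and can bear the large factor, and a partial sum of
      the right half.\<close>
    have pointwise: "D m n w \<le> ennreal (3/2) * D m h w + ennreal (3/2) * D (Suc h) n w
        + ennreal 14641 * ennreal ((\<Sum>i=m..<Suc h. Z i w)^4)" for w
      unfolding D_def[of m n]
    proof (rule SUP_least)
      fix k assume k: "k \<in> {m..n}"
      show "ennreal ((\<Sum>i=m..<k. Z i w)^4) \<le> ennreal (3/2) * D m h w + ennreal (3/2) * D (Suc h) n w
        + ennreal 14641 * ennreal ((\<Sum>i=m..<Suc h. Z i w)^4)"
      proof (cases "k \<le> h")
        case True
        have "ennreal ((\<Sum>i=m..<k. Z i w)^4) = 1 * ennreal ((\<Sum>i=m..<k. Z i w)^4)" by simp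
        also have "\<dots> \<le> ennreal (3/2) * D m h w"
          unfolding D_def using k True by (intro mult_mono SUP_upper) (auto simp flip: ennreal_1)
        finally show ?thesis by (simp add: add_increasing2)
      next
        case False
        have split: "(\<Sum>i=m..<k. Z i w) = (\<Sum>i=m..<Suc h. Z i w) + (\<Sum>i=Suc h..<k. Z i w)"
          using False h by (subst sum.atLeastLessThan_concat) auto
        have "ennreal ((\<Sum>i=m..<k. Z i w)^4) \<le>
            ennreal (3/2 * (\<Sum>i=Suc h..<k. Z i w)^4 + 14641 * (\<Sum>i=m..<Suc h. Z i w)^4)"
          unfolding split by (intro ennreal_leI fourth_power_add_le)
        also have "\<dots> = ennreal (3/2) * ennreal ((\<Sum>i=Suc h..<k. Z i w)^4) +
            ennreal 14641 * ennreal ((\<Sum>i=m..<Suc h. Z i w)^4)"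
          by (rule lin) auto
        also have "\<dots> \<le> ennreal (3/2) * D (Suc h) n w +
            ennreal 14641 * ennreal ((\<Sum>i=m..<Suc h. Z i w)^4)"
          unfolding D_def using k False by (intro add_mono mult_left_mono SUP_upper) auto
        finally show ?thesis by (simp add: add_increasing add.assoc)
      qed
    qed
    have "(\<integral>\<^sup>+w. D m n w \<partial>M) \<le> (\<integral>\<^sup>+w. ennreal (3/2) * D m h w + ennreal (3/2) * D (Suc h) n w
        + ennreal 14641 * ennreal ((\<Sum>i=m..<Suc h. Z i w)^4) \<partial>M)"
      by (intro nn_integral_mono pointwise)
    also have "\<dots> = ennreal (3/2) * (\<integral>\<^sup>+w. D m h w \<partial>M) + ennreal (3/2) * (\<integral>\<^sup>+w. D (Suc h) n w \<partial>M)
        + ennreal 14641 * (\<integral>\<^sup>+w. ennreal ((\<Sum>i=m..<Suc h. Z i w)^4) \<partial>M)"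
      by (simp add: nn_integral_add nn_integral_cmult del: sum.op_ivl_Suc)
    also have "\<dots> \<le> ennreal (3/2) * ennreal (14641 * K * u\<^sup>2) + ennreal (3/2) * ennreal (14641 * K * u\<^sup>2)
        + ennreal 14641 * ennreal (K * u\<^sup>2)"
      by (intro add_mono mult_left_mono 1 2 3) auto
    also have "\<dots> = ennreal (58564 * K * u\<^sup>2)"
    proof -
      have "ennreal (3/2) * ennreal (14641 * K * u\<^sup>2) = ennreal (3/2 * (14641 * K * u\<^sup>2))"
        using K by (intro ennreal_mult[symmetric]) auto
      moreover have "ennreal 14641 * ennreal (K * u\<^sup>2) = ennreal (14641 * (K * u\<^sup>2))"
        using K by (intro ennreal_mult[symmetric]) auto
      ultimately show ?thesis
        using K by (simp only:) (simp add: ennreal_plus[symmetric] del: ennreal_plus)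
    qed
    finally show ?thesis by (simp add: D_def u_def)
  qed
qed

text \<open>Applied to tails, the maximal inequality forces the Cauchy property almost surely. The
  supremum from index 0 also yields a dominating function, so that expectations pass to the
  limit.\<close>

lemma fourth_moment_series:
  fixes Z :: "nat \<Rightarrow> 'a \<Rightarrow> real" and v :: "nat \<Rightarrow> real"
  assumes M: "finite_measure M"
    and Z[measurable]: "\<And>i. Z i \<in> borel_measurable M" and v: "\<And>i. 0 \<le> v i" and K: "0 \<le> K"
    and moment: "\<And>m n. (\<integral>\<^sup>+w. ennreal ((\<Sum>i=m..<n. Z i w)^4) \<partial>M) \<le> ennreal (K * (\<Sum>i=m..<n. v i)\<^sup>2)"
    and summable_v: "summable v"
  shows fourth_moment_series_summable: "AE w in M. summable (\<lambda>i. Z i w)"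
    and fourth_moment_series_integrable: "integrable M (\<lambda>w. \<Sum>i. Z i w)"
    and fourth_moment_series_integral: "(\<lambda>n. \<integral>w. (\<Sum>i<n. Z i w) \<partial>M) \<longlonglongrightarrow> (\<integral>w. (\<Sum>i. Z i w) \<partial>M)"
proof -
  interpret finite_measure M by (rule M)
  define D where "D m w = (SUP k\<in>{m..}. ennreal ((\<Sum>i=m..<k. Z i w)^4))" for m w
  have [measurable]: "D m \<in> borel_measurable M" for m
    unfolding D_def by measurable
  define tail where "tail m = (\<Sum>i. v (i + m))" for m
  have tail: "tail \<longlonglongrightarrow> 0"
    unfolding tail_def[abs_def] using summable_v by (rule suminf_exist_split2)
  have partial: "(\<Sum>i=m..<n. v i) \<le> tail m" for m n
  proof -
    have "(\<Sum>i=m..<n. v i) = (\<Sum>i<n - m. v (i + m))"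
      using sum.shift_bounds_nat_ivl[of v 0 m "n - m"]
      by (cases "m \<le> n") (auto simp: lessThan_atLeast0)
    also have "\<dots> \<le> tail m"
      unfolding tail_def using summable_v v
      by (intro sum_le_suminf) (auto simp: summable_iff_shift)
    finally show ?thesis .
  qed
  have D_bound: "(\<integral>\<^sup>+w. D m w \<partial>M) \<le> ennreal (58564 * K * (tail m)\<^sup>2)" for m
  proof -
    \<comment> \<open>Written as an increasing limit of finite maxima, the supremum inherits the
      maximal inequality by monotone convergence.\<close>
    have "D m w = (SUP n. SUP k\<in>{m..n}. ennreal ((\<Sum>i=m..<k. Z i w)^4))" for w
      unfolding D_def
    proof (rule antisym)
      show "(SUP k\<in>{m..}. ennreal ((\<Sum>i=m..<k. Z i w)^4)) \<le>
          (SUP n. SUP k\<in>{m..n}. ennreal ((\<Sum>i=m..<k. Z i w)^4))"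
      proof (rule SUP_least)
        fix k assume "k \<in> {m..}"
        then show "ennreal ((\<Sum>i=m..<k. Z i w)^4) \<le> (SUP n. SUP k\<in>{m..n}. ennreal ((\<Sum>i=m..<k. Z i w)^4))"
          by (intro SUP_upper2[of k UNIV] SUP_upper2[of k "{m..k}"]) auto
      qed
    qed (auto intro!: SUP_least intro: SUP_upper)
    then have "(\<integral>\<^sup>+w. D m w \<partial>M) =
        (\<integral>\<^sup>+w. (SUP n. SUP k\<in>{m..n}. ennreal ((\<Sum>i=m..<k. Z i w)^4)) \<partial>M)"
      by simp
    also have "\<dots> = (SUP n. \<integral>\<^sup>+w. (SUP k\<in>{m..n}. ennreal ((\<Sum>i=m..<k. Z i w)^4)) \<partial>M)"
      by (intro nn_integral_monotone_convergence_SUP)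
         (auto simp: incseq_def le_fun_def intro!: SUP_subset_mono)
    also have "\<dots> \<le> ennreal (58564 * K * (tail m)\<^sup>2)"
    proof (rule SUP_least)
      fix n
      have "(\<Sum>i=m..<n. v i)\<^sup>2 \<le> (tail m)\<^sup>2"
        using v by (intro power_mono partial sum_nonneg)
      from mult_left_mono[OF this, of "58564 * K"] K
      show "(\<integral>\<^sup>+w. (SUP k\<in>{m..n}. ennreal ((\<Sum>i=m..<k. Z i w)^4)) \<partial>M) \<le> ennreal (58564 * K * (tail m)\<^sup>2)"
        by (intro order_trans[OF fourth_moment_maximal_inequality[OF Z v K moment]] ennreal_leI) auto
    qed
    finally show ?thesis .
  qed

  have "(\<integral>\<^sup>+w. (INF m. D m w) \<partial>M) \<le> ennreal (58564 * K * (tail m)\<^sup>2)" for m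
    by (rule order_trans[OF nn_integral_mono D_bound[of m]]) (auto intro: INF_lower)
  moreover have "(\<lambda>m. ennreal (58564 * K * (tail m)\<^sup>2)) \<longlonglongrightarrow> ennreal (58564 * K * 0\<^sup>2)"
    by (intro tendsto_intros tail tendsto_ennrealI)
  ultimately have "(\<integral>\<^sup>+w. (INF m. D m w) \<partial>M) \<le> ennreal (58564 * K * 0\<^sup>2)"
    by (intro LIMSEQ_le_const) auto
  then have "(\<integral>\<^sup>+w. (INF m. D m w) \<partial>M) = 0" by simp
  then have AE0: "AE w in M. (INF m. D m w) = 0"
    by (subst (asm) nn_integral_0_iff_AE) auto
  show summable: "AE w in M. summable (\<lambda>i. Z i w)"
    using AE0
  proof eventually_elim
    case (elim w)
    show ?case
      unfolding summable_Cauchy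
    proof (intro allI impI)
      fix r :: real assume r: "0 < r"
      \<comment> \<open>A block beyond \<open>N\<close> is the difference of two blocks that start
        at \<open>N\<close>, so each of these is allotted \<open>r / 2\<close>.\<close>
      have "(INF m. D m w) < ennreal ((r / 2)^4)" using elim r by simp
      then obtain N where N: "D N w < ennreal ((r / 2)^4)"
        by (auto simp: INF_less_iff)
      have bd: "\<bar>\<Sum>i=N..<k. Z i w\<bar> < r / 2" if "N \<le> k" for k
      proof -
        have "ennreal ((\<Sum>i=N..<k. Z i w)^4) \<le> D N w"
          unfolding D_def using that by (intro SUP_upper) auto
        with N have "ennreal ((\<Sum>i=N..<k. Z i w)^4) < ennreal ((r / 2)^4)" by simp
        then have "\<bar>\<Sum>i=N..<k. Z i w\<bar>^4 < (r / 2)^4"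
          by (simp add: ennreal_less_iff)
        then show ?thesis by (rule power_less_imp_less_base) (use r in simp)
      qed
      show "\<exists>N. \<forall>m\<ge>N. \<forall>n. norm (\<Sum>i=m..<n. Z i w) < r"
      proof (intro exI[of _ N] allI impI)
        fix m n assume m: "N \<le> m"
        show "norm (\<Sum>i=m..<n. Z i w) < r"
        proof (cases "m \<le> n")
          case True
          have "(\<Sum>i=N..<n. Z i w) = (\<Sum>i=N..<m. Z i w) + (\<Sum>i=m..<n. Z i w)"
            using m True by (subst sum.atLeastLessThan_concat) auto
          moreover have "\<bar>\<Sum>i=N..<m. Z i w\<bar> < r / 2" "\<bar>\<Sum>i=N..<n. Z i w\<bar> < r / 2"
            using bd m True by auto
          ultimately show ?thesis unfolding real_norm_def by linarith
        qed (use r in simp)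
      qed
    qed
  qed

  have D0_fin: "(\<integral>\<^sup>+w. D 0 w \<partial>M) < \<infinity>"
    using le_less_trans[OF D_bound[of 0] ennreal_less_top] by simp
  then have "AE w in M. D 0 w \<noteq> \<infinity>"
    by (intro nn_integral_PInf_AE) auto
  \<comment> \<open>The estimate \<open>\<bar>s\<bar> \<le> 1 + s^4\<close> turns the supremum into
    one integrable bound for all partial sums. Finiteness of \<open>D 0 w\<close> matters because
    \<open>enn2real\<close> sends infinity to 0.\<close>
  then have bound: "AE w in M. norm (\<Sum>i<n. Z i w) \<le> 1 + enn2real (D 0 w)" for n
  proof eventually_elim
    case (elim w)
    define s where "s = (\<Sum>i<n. Z i w)"
    have "ennreal (s^4) \<le> D 0 w"
      unfolding D_def s_def lessThan_atLeast0 by (intro SUP_upper) auto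
    then have "s^4 \<le> enn2real (D 0 w)"
      using elim by (cases "D 0 w" rule: ennreal_cases) auto
    moreover have "\<bar>s\<bar> \<le> 1 + s^4"
    proof (cases "\<bar>s\<bar> \<le> 1")
      case True then show ?thesis by (simp add: add_increasing2)
    next
      case False
      then have "\<bar>s\<bar>^1 \<le> \<bar>s\<bar>^4" by (intro power_increasing) auto
      then show ?thesis by simp
    qed
    ultimately show ?case by (simp add: s_def)
  qed
  have "(\<integral>\<^sup>+w. ennreal (norm (enn2real (D 0 w))) \<partial>M) \<le> (\<integral>\<^sup>+w. D 0 w \<partial>M)"
    by (intro nn_integral_mono) (simp add: ennreal_enn2real_if)
  then have "integrable M (\<lambda>w. enn2real (D 0 w))"
    using D0_fin by (intro integrableI_bounded) auto
  then have int: "integrable M (\<lambda>w. 1 + enn2real (D 0 w))" by simp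
  have lim: "AE w in M. (\<lambda>n. \<Sum>i<n. Z i w) \<longlonglongrightarrow> (\<Sum>i. Z i w)"
    using summable by eventually_elim (rule summable_LIMSEQ)
  show "integrable M (\<lambda>w. \<Sum>i. Z i w)"
    by (rule integrable_dominated_convergence[OF _ _ int lim bound]) auto
  show "(\<lambda>n. \<integral>w. (\<Sum>i<n. Z i w) \<partial>M) \<longlonglongrightarrow> (\<integral>w. (\<Sum>i. Z i w) \<partial>M)"
    by (rule integral_dominated_convergence[OF _ _ int lim bound]) auto
qed

section \<open>Integrals of a Gaussian process\<close>

lemma quadratic_nonneg_discriminant:
  fixes a b c :: real
  assumes c: "0 \<le> c" and q: "\<And>t. 0 \<le> a - 2 * t * b + t\<^sup>2 * c"
  shows "b\<^sup>2 \<le> a * c"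
proof (cases "c = 0")
  case True
  have "b = 0"
  proof (rule ccontr)
    assume "b \<noteq> 0"
    \<comment> \<open>At this point the expression, now linear in \<open>t\<close>, has the value
      -1.\<close>
    with q[of "(a + 1) / (2 * b)"] True show False by simp
  qed
  then show ?thesis using True by simp
next
  case False
  with c have c: "0 < c" by simp
  \<comment> \<open>The value \<open>b / c\<close> minimises the quadratic.\<close>
  have "a - 2 * (b / c) * b + (b / c)\<^sup>2 * c = a - b\<^sup>2 / c"
    using c by (simp add: power2_eq_square field_simps)
  with q[of "b / c"] have "b\<^sup>2 / c \<le> a" by simp
  with c show ?thesis by (simp add: field_simps)
qed

lemma integrable_mult_of_squares:
  fixes f g :: "'a \<Rightarrow> real"
  assumes [measurable]: "f \<in> borel_measurable M" "g \<in> borel_measurable M"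
    and "integrable M (\<lambda>x. (f x)\<^sup>2)" "integrable M (\<lambda>x. (g x)\<^sup>2)"
  shows "integrable M (\<lambda>x. f x * g x)"
proof (rule Bochner_Integration.integrable_bound)
  show "integrable M (\<lambda>x. (f x)\<^sup>2 + (g x)\<^sup>2)" using assms by simp
  show "AE x in M. norm (f x * g x) \<le> norm ((f x)\<^sup>2 + (g x)\<^sup>2)"
  proof (rule AE_I2)
    fix x
    have "2 * (\<bar>f x\<bar> * \<bar>g x\<bar>) \<le> (f x)\<^sup>2 + (g x)\<^sup>2"
      using sum_squares_bound[of "\<bar>f x\<bar>" "\<bar>g x\<bar>"] by simp
    moreover have "0 \<le> \<bar>f x\<bar> * \<bar>g x\<bar>" by simp
    ultimately show "norm (f x * g x) \<le> norm ((f x)\<^sup>2 + (g x)\<^sup>2)"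
      unfolding real_norm_def abs_mult by linarith
  qed
qed measurable

lemma (in finite_measure) L2_imp_integrable:
  fixes f :: "'a \<Rightarrow> real"
  assumes "f \<in> L2 M"
  shows "integrable M f"
  using assms unfolding L2_def by (blast intro: square_integrable_imp_integrable)

lemma integral_square_sub_scaled:
  fixes f g :: "'a \<Rightarrow> real"
  assumes f: "f \<in> L2 M" and g: "g \<in> L2 M"
  shows "(\<lambda>x. f x - t * g x) \<in> L2 M"
    and "(\<integral>x. (f x - t * g x)\<^sup>2 \<partial>M) = (\<integral>x. (f x)\<^sup>2 \<partial>M) - 2 * t * (\<integral>x. f x * g x \<partial>M) + t\<^sup>2 * (\<integral>x. (g x)\<^sup>2 \<partial>M)"
proof -
  have [measurable]: "f \<in> borel_measurable M" "g \<in> borel_measurable M"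
    using assms by (auto simp: L2_def)
  have i: "integrable M (\<lambda>x. (f x)\<^sup>2)" "integrable M (\<lambda>x. (g x)\<^sup>2)" "integrable M (\<lambda>x. f x * g x)"
    using assms by (auto simp: L2_def intro!: integrable_mult_of_squares)
  have eq: "(f x - t * g x)\<^sup>2 = (f x)\<^sup>2 - 2 * t * (f x * g x) + t\<^sup>2 * (g x)\<^sup>2" for x
    by (simp add: power2_eq_square algebra_simps)
  show "(\<lambda>x. f x - t * g x) \<in> L2 M"
    using i by (simp add: L2_def eq)
  show "(\<integral>x. (f x - t * g x)\<^sup>2 \<partial>M) = (\<integral>x. (f x)\<^sup>2 \<partial>M) - 2 * t * (\<integral>x. f x * g x \<partial>M) + t\<^sup>2 * (\<integral>x. (g x)\<^sup>2 \<partial>M)"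
    using i by (simp add: eq)
qed

lemma integral_mult_square_le:
  fixes f g :: "'a \<Rightarrow> real"
  assumes f: "f \<in> L2 M" and g: "g \<in> L2 M"
  shows "(\<integral>x. f x * g x \<partial>M)\<^sup>2 \<le> (\<integral>x. (f x)\<^sup>2 \<partial>M) * (\<integral>x. (g x)\<^sup>2 \<partial>M)"
proof (rule quadratic_nonneg_discriminant)
  fix t
  have "0 \<le> (\<integral>x. (f x - t * g x)\<^sup>2 \<partial>M)" by simp
  then show "0 \<le> (\<integral>x. (f x)\<^sup>2 \<partial>M) - 2 * t * (\<integral>x. f x * g x \<partial>M) + t\<^sup>2 * (\<integral>x. (g x)\<^sup>2 \<partial>M)"
    by (simp only: integral_square_sub_scaled(2)[OF f g])
qed simp

lemma L2_add_scaled: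
  fixes f g :: "'a \<Rightarrow> real"
  assumes "f \<in> L2 M" and "g \<in> L2 M"
  shows "(\<lambda>x. f x + t * g x) \<in> L2 M"
  using integral_square_sub_scaled(1)[OF assms, of "- t"] by simp

lemma L2_sum:
  assumes "\<And>i. i \<in> F \<Longrightarrow> f i \<in> L2 M"
  shows "(\<lambda>x. \<Sum>i\<in>F. c i * f i x) \<in> L2 M"
  using assms
proof (induction F rule: infinite_finite_induct)
  case (insert i F)
  then show ?case using L2_add_scaled[of "\<lambda>x. \<Sum>i\<in>F. c i * f i x" M "f i" "c i"]
    by (simp add: add.commute)
qed (auto simp: L2_def)

lemma l2_norm_eq_0_imp_AE:
  assumes f: "f \<in> L2 M" and "l2_norm M f = 0"
  shows "AE x in M. f x = 0"
proof -
  have "(\<integral>x. (f x)\<^sup>2 \<partial>M) = 0"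
    using assms(2) by (simp add: l2_norm_def l2_inner_def power2_eq_square)
  moreover have "integrable M (\<lambda>x. (f x)\<^sup>2)" using f by (simp add: L2_def)
  ultimately show ?thesis
    by (subst (asm) integral_nonneg_eq_0_iff_AE) auto
qed

text \<open>Only the coefficient with index \<open>j\<close> of \<open>e j\<close> is nonzero, so
  the partial sums are constant once \<open>n\<close> exceeds \<open>j\<close>; their distance to
  \<open>g\<close> is then constant and has limit 0.\<close>

lemma power_image_basis:
  assumes basis: "l2_orthonormal_basis M e" and g: "is_power_image M e mu a (e j) g"
  shows "AE x in M. g x = mu j powr a * e j x"
proof -
  have e: "e j \<in> L2 M" and on: "\<And>i. l2_inner M (e j) (e i) = (if j = i then 1 else 0)"
    using basis by (auto simp: l2_orthonormal_basis_def)
  have gL2: "g \<in> L2 M"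
    and lim: "(\<lambda>n. l2_norm M (\<lambda>x. (\<Sum>i<n. power_coeff M e mu a (e j) i * e i x) - g x)) \<longlonglongrightarrow> 0"
    using g by (auto simp: is_power_image_def l2_sums_def)
  have "(\<Sum>i<n. power_coeff M e mu a (e j) i * e i x) = mu j powr a * e j x" if "j < n" for n x
  proof -
    have "(\<Sum>i<n. power_coeff M e mu a (e j) i * e i x) = (\<Sum>i<n. if i = j then mu j powr a * e j x else 0)"
      by (intro sum.cong) (auto simp: power_coeff_def l2_coeff_def on)
    with that show ?thesis by simp
  qed
  then have "(\<lambda>n. l2_norm M (\<lambda>x. (\<Sum>i<n. power_coeff M e mu a (e j) i * e i x) - g x))
      \<longlonglongrightarrow> l2_norm M (\<lambda>x. mu j powr a * e j x - g x)"
    by (intro tendsto_eventually eventually_mono[OF eventually_gt_at_top[of j]]) simp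
  with lim have 0: "l2_norm M (\<lambda>x. mu j powr a * e j x - g x) = 0"
    using LIMSEQ_unique by blast
  have "(\<lambda>x. mu j powr a * e j x - g x) \<in> L2 M"
    using integral_square_sub_scaled(1)[OF L2_sum[of "{j}" e M "\<lambda>_. mu j powr a"] gL2, of 1] e by simp
  from l2_norm_eq_0_imp_AE[OF this 0] show ?thesis by eventually_elim simp
qed

text \<open>A degenerate variable of mean 0 vanishes almost surely; otherwise the centred normal law
  gives the fourth moment as exactly three times the squared variance.\<close>

lemma gaussian_rv_moments:
  assumes P: "prob_space P" and Z: "gaussian_rv P Z" and mean: "(\<integral>w. Z w \<partial>P) = 0"
  shows "integrable P Z" "Z \<in> L2 P" "integrable P (\<lambda>w. (Z w)^4)"
    "(\<integral>w. (Z w)^4 \<partial>P) \<le> 3 * (\<integral>w. (Z w)\<^sup>2 \<partial>P)\<^sup>2"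
proof -
  interpret prob_space P by (rule P)
  have Zm[measurable]: "Z \<in> borel_measurable P" using Z by (simp add: gaussian_rv_def)
  have "integrable P Z \<and> Z \<in> L2 P \<and> integrable P (\<lambda>w. (Z w)^4) \<and>
    (\<integral>w. (Z w)^4 \<partial>P) \<le> 3 * (\<integral>w. (Z w)\<^sup>2 \<partial>P)\<^sup>2"
    using Z unfolding gaussian_rv_def
  proof (elim conjE disjE exE)
    fix m assume m: "AE w in P. Z w = m"
    have eq: "(\<integral>w. Z w \<partial>P) = (\<integral>w. m \<partial>P)"
      by (rule integral_cong_AE) (use m in auto)
    with mean have "m = 0" by (simp add: prob_space)
    with m have ae: "AE w in P. Z w = 0" by simp
    have "integrable P (\<lambda>w. (Z w)^k)" if "0 < k" for k
      by (subst integrable_cong_AE[where g="\<lambda>_. 0"]) (use ae that in auto)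
    from this[of 1] this[of 2] this[of 4]
    have "integrable P Z" "integrable P (\<lambda>w. (Z w)\<^sup>2)" "integrable P (\<lambda>w. (Z w)^4)" by auto
    moreover have "(\<integral>w. (Z w)^4 \<partial>P) = (\<integral>w. 0 \<partial>P)"
      by (rule integral_cong_AE) (use ae in auto)
    ultimately show ?thesis by (simp add: L2_def)
  next
    fix m \<sigma> :: real assume \<sigma>: "0 < \<sigma>" and d: "distributed P lborel Z (normal_density m \<sigma>)"
    have m: "m = 0" using normal_distributed_expectation[OF \<sigma> d] mean by simp
    have int: "integrable P (\<lambda>w. (Z w)^k)" for k
      using integrable_normal_moment[OF \<sigma>, of m k] m
      by (subst distributed_integrable[OF d, symmetric]) auto
    have val: "(\<integral>w. (Z w)^(2 * k) \<partial>P) = fact (2 * k) / ((2 / \<sigma>\<^sup>2)^k * fact k)" for k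
      using integral_normal_moment_even[OF \<sigma>, of m k] m
      by (subst distributed_integral[OF d, symmetric]) auto
    have "(\<integral>w. (Z w)\<^sup>2 \<partial>P) = \<sigma>\<^sup>2" using val[of 1] by simp
    moreover have "(\<integral>w. (Z w)^4 \<partial>P) = 3 * (\<sigma>\<^sup>2)\<^sup>2"
      using val[of 2] \<sigma> by (simp add: fact_numeral field_simps power2_eq_square)
    ultimately show ?thesis using int[of 1] int[of 2] int[of 4] by (simp add: L2_def)
  qed
  then show "integrable P Z" "Z \<in> L2 P" "integrable P (\<lambda>w. (Z w)^4)"
    "(\<integral>w. (Z w)^4 \<partial>P) \<le> 3 * (\<integral>w. (Z w)\<^sup>2 \<partial>P)\<^sup>2" by auto
qed

text \<open>The linear span of the values of the process, without closure: precisely the variables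
  that \<open>gaussian_process\<close> declares to be Gaussian.\<close>

definition finite_combinations :: "('x \<Rightarrow> 'w \<Rightarrow> real) \<Rightarrow> ('w \<Rightarrow> real) set" where
  "finite_combinations \<epsilon> = {h. \<exists>S a. finite S \<and> h = (\<lambda>w. \<Sum>s\<in>S. a s * \<epsilon> s w)}"

lemma finite_combinations_add_scaled:
  assumes "h \<in> finite_combinations \<epsilon>" "k \<in> finite_combinations \<epsilon>"
  shows "(\<lambda>w. h w + t * k w) \<in> finite_combinations \<epsilon>"
proof -
  obtain S a where h: "finite S" "h = (\<lambda>w. \<Sum>s\<in>S. a s * \<epsilon> s w)"
    using assms(1) by (auto simp: finite_combinations_def)
  obtain T b where k: "finite T" "k = (\<lambda>w. \<Sum>s\<in>T. b s * \<epsilon> s w)"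
    using assms(2) by (auto simp: finite_combinations_def)
  define c where "c s = (if s \<in> S then a s else 0) + t * (if s \<in> T then b s else 0)" for s
  have "h w + t * k w = (\<Sum>s\<in>S \<union> T. c s * \<epsilon> s w)" for w
  proof -
    have "h w = (\<Sum>s\<in>S \<union> T. (if s \<in> S then a s else 0) * \<epsilon> s w)"
      unfolding h(2) using h(1) k(1) by (intro sum.mono_neutral_cong_left) auto
    moreover have "k w = (\<Sum>s\<in>S \<union> T. (if s \<in> T then b s else 0) * \<epsilon> s w)"
      unfolding k(2) using h(1) k(1) by (intro sum.mono_neutral_cong_left) auto
    ultimately show ?thesis
      by (simp add: c_def sum_distrib_left sum.distrib[symmetric] algebra_simps del: sum.distrib)
  qed
  then show ?thesis using h(1) k(1)
    unfolding finite_combinations_def by (auto intro!: exI[of _ "S \<union> T"] exI[of _ c])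
qed

text \<open>The second-order setting for Fubini, without Gaussianity. The values
  \<open>\<epsilon> s\<close> are square integrable for every \<open>s\<close>, not just almost
  every one, because single values enter \<open>finite_combinations\<close>.\<close>

locale square_integrable_process = prob_space P + nu: finite_measure \<nu>
  for P :: "'w measure" and \<nu> :: "'x measure" and \<epsilon> :: "'x \<Rightarrow> 'w \<Rightarrow> real" +
  assumes joint_measurable[measurable]: "(\<lambda>(s, w). \<epsilon> s w) \<in> borel_measurable (\<nu> \<Otimes>\<^sub>M P)"
    and joint_square_integrable: "integrable (\<nu> \<Otimes>\<^sub>M P) (\<lambda>(s, w). (\<epsilon> s w)\<^sup>2)"
    and section_L2: "\<And>s. \<epsilon> s \<in> L2 P"
begin

sublocale pair_sigma_finite \<nu> P ..

abbreviation integrated :: "('x \<Rightarrow> real) \<Rightarrow> 'w \<Rightarrow> real" where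
  "integrated g w \<equiv> l2_inner \<nu> (\<lambda>s. \<epsilon> s w) g"

lemma AE_path_L2: "AE w in P. (\<lambda>s. \<epsilon> s w) \<in> L2 \<nu>"
proof -
  have "AE w in P. integrable \<nu> (\<lambda>s. (\<epsilon> s w)\<^sup>2)"
    using AE_integrable_snd[OF joint_square_integrable] .
  then show ?thesis using AE_space
  proof eventually_elim
    case (elim w)
    have "(\<lambda>s. (s, w)) \<in> \<nu> \<rightarrow>\<^sub>M \<nu> \<Otimes>\<^sub>M P" using elim by simp
    from measurable_compose[OF this joint_measurable] elim show ?case by (simp add: L2_def)
  qed
qed

text \<open>The function \<open>U w * g s\<close> is square integrable on the product space, and so
  is the process, hence their product is integrable. Every exchange of integrals below rests on
  this.\<close>

lemma integrable_mult_section: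
  assumes U: "U \<in> L2 P" and g: "g \<in> L2 \<nu>"
  shows "integrable (\<nu> \<Otimes>\<^sub>M P) (\<lambda>(s, w). U w * (\<epsilon> s w * g s))"
proof -
  have [measurable]: "U \<in> borel_measurable P" "g \<in> borel_measurable \<nu>"
    and i: "integrable P (\<lambda>w. (U w)\<^sup>2)" "integrable \<nu> (\<lambda>s. (g s)\<^sup>2)"
    using assms by (auto simp: L2_def)
  have "integrable (\<nu> \<Otimes>\<^sub>M P) (\<lambda>z. (U (snd z) * g (fst z))\<^sup>2)"
  proof (rule Fubini_integrable)
    show "integrable \<nu> (\<lambda>x. \<integral>y. norm ((U (snd (x, y)) * g (fst (x, y)))\<^sup>2) \<partial>P)"
      using i by (simp add: power_mult_distrib)
  qed (use i in \<open>auto simp: power_mult_distrib\<close>)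
  moreover have "integrable (\<nu> \<Otimes>\<^sub>M P) (\<lambda>z. (\<epsilon> (fst z) (snd z))\<^sup>2)"
    using joint_square_integrable by (simp add: split_beta')
  moreover have "(\<lambda>z. \<epsilon> (fst z) (snd z)) \<in> borel_measurable (\<nu> \<Otimes>\<^sub>M P)"
    using joint_measurable by (simp add: split_beta')
  ultimately have "integrable (\<nu> \<Otimes>\<^sub>M P) (\<lambda>z. (U (snd z) * g (fst z)) * \<epsilon> (fst z) (snd z))"
    by (intro integrable_mult_of_squares) auto
  then show ?thesis by (simp add: split_beta' mult_ac)
qed

lemma one_in_L2: "(\<lambda>_. 1) \<in> L2 P"
  by (simp add: L2_def)

lemma integrated_measurable:
  assumes "g \<in> L2 \<nu>"
  shows "integrated g \<in> borel_measurable P"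
  using integrable_snd[OF integrable_mult_section[OF one_in_L2 assms]]
  by (auto simp: l2_inner_def[abs_def])

text \<open>Cauchy-Schwarz on each path bounds the square by a multiple of the squared path norm,
  which is integrable by Fubini.\<close>

lemma integrated_L2:
  assumes g: "g \<in> L2 \<nu>"
  shows "integrated g \<in> L2 P"
proof -
  note [measurable] = integrated_measurable[OF g]
  have "integrable P (\<lambda>w. (integrated g w)\<^sup>2)"
  proof (rule Bochner_Integration.integrable_bound)
    show "integrable P (\<lambda>w. (\<integral>s. (\<epsilon> s w)\<^sup>2 \<partial>\<nu>) * (\<integral>s. (g s)\<^sup>2 \<partial>\<nu>))"
      using integrable_snd[OF joint_square_integrable] by simp
    show "AE w in P. norm ((integrated g w)\<^sup>2) \<le> norm ((\<integral>s. (\<epsilon> s w)\<^sup>2 \<partial>\<nu>) * (\<integral>s. (g s)\<^sup>2 \<partial>\<nu>))"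
      using AE_path_L2
    proof eventually_elim
      case (elim w)
      from integral_mult_square_le[OF elim g] show ?case by (simp add: l2_inner_def)
    qed
  qed measurable
  then show ?thesis by (simp add: L2_def)
qed

text \<open>Fubini reduces testing against \<open>integrated g\<close> to testing against the single
  values \<open>\<epsilon> s\<close>; both the approximation and the covariance formula below use
  this.\<close>

lemma expectation_mult_integrated:
  assumes U: "U \<in> L2 P" and g: "g \<in> L2 \<nu>"
  shows "integrable \<nu> (\<lambda>s. g s * (\<integral>w. U w * \<epsilon> s w \<partial>P))"
    and "(\<integral>w. U w * integrated g w \<partial>P) = (\<integral>s. g s * (\<integral>w. U w * \<epsilon> s w \<partial>P) \<partial>\<nu>)"
proof -
  note int = integrable_mult_section[OF U g]
  have inner: "(\<integral>w. U w * (\<epsilon> s w * g s) \<partial>P) = g s * (\<integral>w. U w * \<epsilon> s w \<partial>P)" for s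
  proof -
    have "(\<integral>w. U w * (\<epsilon> s w * g s) \<partial>P) = (\<integral>w. (U w * \<epsilon> s w) * g s \<partial>P)"
      by (simp only: mult.assoc)
    also have "\<dots> = (\<integral>w. U w * \<epsilon> s w \<partial>P) * g s" by (rule integral_mult_left_zero)
    finally show ?thesis by (simp only: mult.commute)
  qed
  show "integrable \<nu> (\<lambda>s. g s * (\<integral>w. U w * \<epsilon> s w \<partial>P))"
    using integrable_fst[OF int] by (simp add: inner)
  have "(\<integral>w. U w * integrated g w \<partial>P) = (\<integral>w. (\<integral>s. U w * (\<epsilon> s w * g s) \<partial>\<nu>) \<partial>P)"
    by (simp add: l2_inner_def)
  also have "\<dots> = (\<integral>s. g s * (\<integral>w. U w * \<epsilon> s w \<partial>P) \<partial>\<nu>)"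
    using Fubini_integral[OF int] by (simp add: inner)
  finally show "(\<integral>w. U w * integrated g w \<partial>P) = (\<integral>s. g s * (\<integral>w. U w * \<epsilon> s w \<partial>P) \<partial>\<nu>)" .
qed

lemma finite_combinations_L2: "h \<in> finite_combinations \<epsilon> \<Longrightarrow> h \<in> L2 P"
  unfolding finite_combinations_def by (auto intro: L2_sum section_L2)

lemma section_in_finite_combinations: "\<epsilon> s \<in> finite_combinations \<epsilon>"
  unfolding finite_combinations_def by (auto intro!: exI[of _ "{s}"] exI[of _ "\<lambda>_. 1"])

text \<open>
  Without projections: almost minimality of the distance to \<open>integrated g\<close> makes the residual almost
  orthogonal to every \<open>\<epsilon> s\<close>, hence by Fubini to \<open>integrated g\<close>, hence small.
\<close>

lemma integrated_approximable:
  assumes g: "g \<in> L2 \<nu>" and r: "0 < r"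
  shows "\<exists>h\<in>finite_combinations \<epsilon>. (\<integral>w. (integrated g w - h w)\<^sup>2 \<partial>P) < r"
proof -
  define Z where "Z = integrated g"
  have Z: "Z \<in> L2 P" unfolding Z_def using g by (rule integrated_L2)
  define q where "q h = (\<integral>w. (Z w - h w)\<^sup>2 \<partial>P)" for h
  define I where "I = (INF h\<in>finite_combinations \<epsilon>. q h)"
  have ne: "finite_combinations \<epsilon> \<noteq> {}" using section_in_finite_combinations by blast
  have q_nonneg: "0 \<le> q h" for h by (simp add: q_def)
  have bdd: "bdd_below (q ` finite_combinations \<epsilon>)"
    using q_nonneg by (intro bdd_belowI[of _ 0]) auto
  have I_le: "I \<le> q h" if "h \<in> finite_combinations \<epsilon>" for h
    unfolding I_def using bdd that by (rule cINF_lower)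
  have I_nonneg: "0 \<le> I" unfolding I_def using ne q_nonneg by (intro cINF_greatest) auto
  define G where "G = (\<integral>s. \<bar>g s\<bar> * sqrt (\<integral>w. (\<epsilon> s w)\<^sup>2 \<partial>P) \<partial>\<nu>)"
  have gm[measurable]: "g \<in> borel_measurable \<nu>" using g by (simp add: L2_def)
  have Vint: "integrable \<nu> (\<lambda>s. \<integral>w. (\<epsilon> s w)\<^sup>2 \<partial>P)"
    using integrable_fst[OF joint_square_integrable] .
  then have [measurable]: "(\<lambda>s. \<integral>w. (\<epsilon> s w)\<^sup>2 \<partial>P) \<in> borel_measurable \<nu>" by auto
  have Gint: "integrable \<nu> (\<lambda>s. \<bar>g s\<bar> * sqrt (\<integral>w. (\<epsilon> s w)\<^sup>2 \<partial>P))"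
    using g Vint by (intro integrable_mult_of_squares) (auto simp: L2_def)
  have G: "0 \<le> G" unfolding G_def by (intro integral_nonneg_AE) auto
  \<comment> \<open>\<open>B\<close> bounds the norm of each near-minimiser \<open>h\<close> used
    below, since \<open>h = Z - U\<close> and the squared norm \<open>q h\<close> of
    \<open>U\<close> is below \<open>I + 1\<close>.\<close>
  define B where "B = sqrt (2 * (\<integral>w. (Z w)\<^sup>2 \<partial>P) + 2 * (I + 1))"
  have B: "0 \<le> B" unfolding B_def using I_nonneg by simp
  have main: "I \<le> sqrt \<delta> * (G + B)" if \<delta>: "0 < \<delta>" "\<delta> \<le> 1" for \<delta>
  proof -
    obtain h where h: "h \<in> finite_combinations \<epsilon>" "q h < I + \<delta>"
      using cINF_less_iff[OF ne bdd, of "I + \<delta>"] \<delta> unfolding I_def by auto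
    define U where "U w = Z w - h w" for w
    have U: "U \<in> L2 P"
      unfolding U_def[abs_def] using integral_square_sub_scaled(1)[OF Z finite_combinations_L2[OF h(1)], of 1] by simp
    have orth: "\<bar>\<integral>w. U w * V w \<partial>P\<bar> \<le> sqrt \<delta> * sqrt (\<integral>w. (V w)\<^sup>2 \<partial>P)" if V: "V \<in> finite_combinations \<epsilon>" for V
    proof -
      \<comment> \<open>Moving from \<open>h\<close> in the direction \<open>V\<close> cannot push
        \<open>q\<close> below \<open>I\<close>. Hence \<open>q h - I\<close> takes the place of the
        squared norm of \<open>U\<close> in the Cauchy-Schwarz argument.\<close>
      have "(\<integral>w. U w * V w \<partial>P)\<^sup>2 \<le> (q h - I) * (\<integral>w. (V w)\<^sup>2 \<partial>P)"
      proof (rule quadratic_nonneg_discriminant)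
        fix t
        have "I \<le> q (\<lambda>w. h w + t * V w)"
          using I_le finite_combinations_add_scaled[OF h(1) V] by blast
        also have "\<dots> = (\<integral>w. (U w - t * V w)\<^sup>2 \<partial>P)"
          by (simp add: q_def U_def algebra_simps)
        also have "\<dots> = q h - 2 * t * (\<integral>w. U w * V w \<partial>P) + t\<^sup>2 * (\<integral>w. (V w)\<^sup>2 \<partial>P)"
          using integral_square_sub_scaled(2)[OF U finite_combinations_L2[OF V]]
          by (simp add: q_def U_def)
        finally show "0 \<le> q h - I - 2 * t * (\<integral>w. U w * V w \<partial>P) + t\<^sup>2 * (\<integral>w. (V w)\<^sup>2 \<partial>P)" by simp
      qed simp
      also have "\<dots> \<le> \<delta> * (\<integral>w. (V w)\<^sup>2 \<partial>P)"
        using h(2) by (intro mult_right_mono) auto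
      finally have "sqrt ((\<integral>w. U w * V w \<partial>P)\<^sup>2) \<le> sqrt (\<delta> * (\<integral>w. (V w)\<^sup>2 \<partial>P))"
        by (rule real_sqrt_le_mono)
      then show ?thesis by (simp add: real_sqrt_mult)
    qed
    \<comment> \<open>Fubini replaces \<open>Z\<close> by the values \<open>\<epsilon> s\<close>,
      each of them almost orthogonal to \<open>U\<close>; \<open>G\<close> collects their norms,
      weighted by \<open>\<bar>g s\<bar>\<close>.\<close>
    have 1: "\<bar>\<integral>w. U w * Z w \<partial>P\<bar> \<le> sqrt \<delta> * G"
    proof -
      have "\<bar>\<integral>w. U w * Z w \<partial>P\<bar> = \<bar>\<integral>s. g s * (\<integral>w. U w * \<epsilon> s w \<partial>P) \<partial>\<nu>\<bar>"
        unfolding Z_def by (simp only: expectation_mult_integrated(2)[OF U g])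
      also have "\<dots> \<le> (\<integral>s. \<bar>g s * (\<integral>w. U w * \<epsilon> s w \<partial>P)\<bar> \<partial>\<nu>)"
        by (rule integral_abs_bound)
      also have "\<dots> \<le> (\<integral>s. sqrt \<delta> * (\<bar>g s\<bar> * sqrt (\<integral>w. (\<epsilon> s w)\<^sup>2 \<partial>P)) \<partial>\<nu>)"
      proof (rule integral_mono)
        show "integrable \<nu> (\<lambda>s. \<bar>g s * (\<integral>w. U w * \<epsilon> s w \<partial>P)\<bar>)"
          using expectation_mult_integrated(1)[OF U g] by (rule integrable_abs)
        show "integrable \<nu> (\<lambda>s. sqrt \<delta> * (\<bar>g s\<bar> * sqrt (\<integral>w. (\<epsilon> s w)\<^sup>2 \<partial>P)))"
          using Gint by simp
        fix s
        show "\<bar>g s * (\<integral>w. U w * \<epsilon> s w \<partial>P)\<bar> \<le> sqrt \<delta> * (\<bar>g s\<bar> * sqrt (\<integral>w. (\<epsilon> s w)\<^sup>2 \<partial>P))"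
          using mult_left_mono[OF orth[OF section_in_finite_combinations[of s]], of "\<bar>g s\<bar>"]
          by (simp add: abs_mult mult_ac)
      qed
      finally show ?thesis by (simp add: G_def)
    qed
    have "(\<integral>w. (h w)\<^sup>2 \<partial>P) \<le> (\<integral>w. 2 * (Z w)\<^sup>2 + 2 * (U w)\<^sup>2 \<partial>P)"
    proof (rule integral_mono)
      show "integrable P (\<lambda>w. (h w)\<^sup>2)" "integrable P (\<lambda>w. 2 * (Z w)\<^sup>2 + 2 * (U w)\<^sup>2)"
        using Z U finite_combinations_L2[OF h(1)] by (auto simp: L2_def)
      fix w
      have "0 \<le> (2 * Z w - h w)\<^sup>2" by simp
      then show "(h w)\<^sup>2 \<le> 2 * (Z w)\<^sup>2 + 2 * (U w)\<^sup>2"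
        by (simp add: U_def power2_eq_square algebra_simps)
    qed
    also have "\<dots> = 2 * (\<integral>w. (Z w)\<^sup>2 \<partial>P) + 2 * q h"
      using Z U by (simp add: L2_def q_def U_def)
    also have "\<dots> \<le> 2 * (\<integral>w. (Z w)\<^sup>2 \<partial>P) + 2 * (I + 1)" using h(2) \<delta> by simp
    finally have "sqrt (\<integral>w. (h w)\<^sup>2 \<partial>P) \<le> B" unfolding B_def by (rule real_sqrt_le_mono)
    then have 2: "\<bar>\<integral>w. U w * h w \<partial>P\<bar> \<le> sqrt \<delta> * B"
      using \<delta> by (intro order_trans[OF orth[OF h(1)]] mult_left_mono) auto
    have "integrable P (\<lambda>w. U w * Z w)" "integrable P (\<lambda>w. U w * h w)"
      using Z U finite_combinations_L2[OF h(1)] by (auto simp: L2_def intro!: integrable_mult_of_squares)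
    \<comment> \<open>One factor \<open>U\<close> is kept and the other expanded, so the squared
      distance is the difference of the two inner products just bounded.\<close>
    moreover have "(Z w - h w)\<^sup>2 = U w * Z w - U w * h w" for w
      by (simp add: U_def power2_eq_square algebra_simps)
    ultimately have "q h = (\<integral>w. U w * Z w \<partial>P) - (\<integral>w. U w * h w \<partial>P)"
      by (simp add: q_def)
    then have "q h \<le> sqrt \<delta> * G + sqrt \<delta> * B" using 1 2 by linarith
    with I_le[OF h(1)] show ?thesis by (simp add: distrib_left)
  qed
  have "I \<le> 0"
  proof (rule ccontr)
    assume "\<not> I \<le> 0"
    then have I: "0 < I" by simp
    \<comment> \<open>With this choice \<open>sqrt \<delta> * (G + B)\<close> is strictly below
      \<open>I\<close>, against \<open>main\<close>.\<close>
    define \<delta> where "\<delta> = min 1 ((I / (G + B + 1))\<^sup>2)"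
    have "0 < \<delta>" "\<delta> \<le> 1" using I G B by (auto simp: \<delta>_def)
    then have "I \<le> sqrt \<delta> * (G + B)" by (rule main)
    also have "\<dots> \<le> sqrt ((I / (G + B + 1))\<^sup>2) * (G + B)"
      using G B unfolding \<delta>_def by (intro mult_right_mono real_sqrt_le_mono) auto
    also have "\<dots> = I * (G + B) / (G + B + 1)" using I G B by simp
    also have "\<dots> < I" using I G B by (simp add: field_simps)
    finally show False by simp
  qed
  with r have "I < r" by simp
  then show ?thesis
    using cINF_less_iff[OF ne bdd, of r] unfolding I_def by (auto simp: q_def Z_def)
qed

lemma expectation_integrated:
  assumes centered: "\<And>s. (\<integral>w. \<epsilon> s w \<partial>P) = 0" and g: "g \<in> L2 \<nu>"
  shows "(\<integral>w. integrated g w \<partial>P) = 0"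
  using expectation_mult_integrated(2)[OF one_in_L2 g] by (simp add: centered)

text \<open>Fubini is used twice: against \<open>h\<close> with \<open>\<epsilon> s\<close> fixed,
  which produces the covariance operator, and then against \<open>g\<close>.\<close>

lemma covariance_integrated:
  assumes centered: "\<And>s. (\<integral>w. \<epsilon> s w \<partial>P) = 0" and g: "g \<in> L2 \<nu>" and h: "h \<in> L2 \<nu>"
  shows "(\<integral>w. integrated g w * integrated h w \<partial>P) =
    l2_inner \<nu> g (covariance_op \<nu> (covariance_fun P \<epsilon>) h)"
proof -
  have "(\<integral>w. integrated h w * \<epsilon> s w \<partial>P) = covariance_op \<nu> (covariance_fun P \<epsilon>) h s" for s
  proof -
    have "(\<integral>w. integrated h w * \<epsilon> s w \<partial>P) = (\<integral>w. \<epsilon> s w * integrated h w \<partial>P)"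
      by (simp add: mult.commute)
    also have "\<dots> = (\<integral>t. h t * (\<integral>w. \<epsilon> s w * \<epsilon> t w \<partial>P) \<partial>\<nu>)"
      by (rule expectation_mult_integrated(2)[OF section_L2 h])
    finally show ?thesis
      by (simp add: covariance_op_def covariance_fun_def centered mult.commute)
  qed
  moreover have "(\<integral>w. integrated g w * integrated h w \<partial>P) = (\<integral>w. integrated h w * integrated g w \<partial>P)"
    by (simp add: mult.commute)
  ultimately show ?thesis
    using expectation_mult_integrated(2)[OF integrated_L2[OF h] g] by (simp add: l2_inner_def)
qed

text \<open>Linearity is claimed only almost surely: on a path that is not square integrable the
  products may fail to be integrable, and their integrals then have the default value 0.\<close>

lemma AE_integrated_sum:
  assumes f: "\<And>i. i \<in> F \<Longrightarrow> f i \<in> L2 \<nu>"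
  shows "AE w in P. integrated (\<lambda>s. \<Sum>i\<in>F. c i * f i s) w = (\<Sum>i\<in>F. c i * integrated (f i) w)"
  using AE_path_L2
proof eventually_elim
  case (elim w)
  have "integrable \<nu> (\<lambda>s. \<epsilon> s w * f i s)" if "i \<in> F" for i
    using elim f[OF that] by (auto simp: L2_def intro!: integrable_mult_of_squares)
  then have int: "integrable \<nu> (\<lambda>s. c i * (\<epsilon> s w * f i s))" if "i \<in> F" for i using that by simp
  have "(\<integral>s. \<epsilon> s w * (\<Sum>i\<in>F. c i * f i s) \<partial>\<nu>) = (\<integral>s. (\<Sum>i\<in>F. c i * (\<epsilon> s w * f i s)) \<partial>\<nu>)"
    by (simp add: sum_distrib_left mult_ac)
  also have "\<dots> = (\<Sum>i\<in>F. \<integral>s. c i * (\<epsilon> s w * f i s) \<partial>\<nu>)"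
    using int by (rule Bochner_Integration.integral_sum)
  finally show ?case by (simp add: l2_inner_def)
qed

text \<open>Only the second moments of the approximants have to converge exactly; for the fourth
  moments the one-sided inequality of Fatou is enough.\<close>

lemma fourth_moment_integrated:
  assumes gauss: "gaussian_process P \<epsilon>" and centered: "\<And>s. (\<integral>w. \<epsilon> s w \<partial>P) = 0" and g: "g \<in> L2 \<nu>"
  shows "(\<integral>\<^sup>+w. ennreal ((integrated g w)^4) \<partial>P) \<le> ennreal (3 * (\<integral>w. (integrated g w)\<^sup>2 \<partial>P)\<^sup>2)"
proof -
  define Z where "Z = integrated g"
  have Z: "Z \<in> L2 P" unfolding Z_def using g by (rule integrated_L2)
  have "\<exists>h\<in>finite_combinations \<epsilon>. (\<integral>w. (Z w - h w)\<^sup>2 \<partial>P) < 1 / real (Suc n)" for n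
    unfolding Z_def using integrated_approximable[OF g, of "1 / real (Suc n)"] by simp
  then obtain h where h: "\<And>n. h n \<in> finite_combinations \<epsilon>"
      "\<And>n. (\<integral>w. (Z w - h n w)\<^sup>2 \<partial>P) < 1 / real (Suc n)"
    by metis
  note hL2 = finite_combinations_L2[OF h(1)]
  define U where "U n w = Z w - h n w" for n w
  have U: "U n \<in> L2 P" for n
    unfolding U_def[abs_def] using integral_square_sub_scaled(1)[OF Z hL2, of 1] by simp
  have [measurable]: "Z \<in> borel_measurable P" "\<And>n. h n \<in> borel_measurable P"
    using Z hL2 by (auto simp: L2_def)
  have U0: "(\<lambda>n. \<integral>w. (U n w)\<^sup>2 \<partial>P) \<longlonglongrightarrow> 0"
  proof (rule real_tendsto_sandwich[where f="\<lambda>_. 0" and h="\<lambda>n. 1 / real (Suc n)"])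
    show "eventually (\<lambda>n. (\<integral>w. (U n w)\<^sup>2 \<partial>P) \<le> 1 / real (Suc n)) sequentially"
      using h(2) by (auto simp: U_def intro!: always_eventually less_imp_le)
    show "(\<lambda>n. 1 / real (Suc n)) \<longlonglongrightarrow> 0"
      using LIMSEQ_inverse_real_of_nat by (simp add: inverse_eq_divide)
  qed auto
  \<comment> \<open>This is the mixed term in the expansion of the square of
    \<open>h n = Z - U n\<close>.\<close>
  have cross: "(\<lambda>n. \<integral>w. Z w * U n w \<partial>P) \<longlonglongrightarrow> 0"
  proof -
    have "(\<lambda>n. (\<integral>w. Z w * U n w \<partial>P)\<^sup>2) \<longlonglongrightarrow> 0"
    proof (rule Lim_null_comparison)
      show "eventually (\<lambda>n. norm ((\<integral>w. Z w * U n w \<partial>P)\<^sup>2) \<le> (\<integral>w. (Z w)\<^sup>2 \<partial>P) * (\<integral>w. (U n w)\<^sup>2 \<partial>P)) sequentially"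
        by (intro always_eventually allI) (simp add: integral_mult_square_le[OF Z U])
      show "(\<lambda>n. (\<integral>w. (Z w)\<^sup>2 \<partial>P) * (\<integral>w. (U n w)\<^sup>2 \<partial>P)) \<longlonglongrightarrow> 0"
        using tendsto_mult_left[OF U0] by simp
    qed
    from tendsto_real_sqrt[OF this] show ?thesis by (simp add: tendsto_rabs_zero_iff)
  qed
  have "(\<integral>w. (h n w)\<^sup>2 \<partial>P) = (\<integral>w. (Z w)\<^sup>2 \<partial>P) - 2 * (\<integral>w. Z w * U n w \<partial>P) + (\<integral>w. (U n w)\<^sup>2 \<partial>P)" for n
    using integral_square_sub_scaled(2)[OF Z U, of 1 n] by (simp add: U_def)
  moreover have "(\<lambda>n. (\<integral>w. (Z w)\<^sup>2 \<partial>P) - 2 * (\<integral>w. Z w * U n w \<partial>P) + (\<integral>w. (U n w)\<^sup>2 \<partial>P))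
      \<longlonglongrightarrow> (\<integral>w. (Z w)\<^sup>2 \<partial>P) - 2 * 0 + 0"
    by (intro tendsto_intros U0 cross)
  ultimately have second: "(\<lambda>n. \<integral>w. (h n w)\<^sup>2 \<partial>P) \<longlonglongrightarrow> (\<integral>w. (Z w)\<^sup>2 \<partial>P)" by simp

  \<comment> \<open>Convergence of the squares in mean gives almost sure convergence along a
    subsequence, which suffices for Fatou.\<close>
  have "\<exists>r::nat\<Rightarrow>nat. strict_mono r \<and> (AE w in P. (\<lambda>n. (U (r n) w)\<^sup>2) \<longlonglongrightarrow> 0)"
    using U U0 by (intro tendsto_L1_AE_subseq) (auto simp: L2_def)
  then obtain r :: "nat \<Rightarrow> nat" where r: "strict_mono r" "AE w in P. (\<lambda>n. (U (r n) w)\<^sup>2) \<longlonglongrightarrow> 0"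
    by blast
  have lim: "AE w in P. ennreal ((Z w)^4) = liminf (\<lambda>n. ennreal ((h (r n) w)^4))"
    using r(2)
  proof eventually_elim
    case (elim w)
    from tendsto_real_sqrt[OF elim] have "(\<lambda>n. U (r n) w) \<longlonglongrightarrow> 0"
      by (simp add: tendsto_rabs_zero_iff)
    then have "(\<lambda>n. Z w - U (r n) w) \<longlonglongrightarrow> Z w - 0" by (intro tendsto_intros)
    then have "(\<lambda>n. ennreal ((h (r n) w)^4)) \<longlonglongrightarrow> ennreal ((Z w)^4)"
      by (intro tendsto_ennrealI tendsto_power) (simp add: U_def)
    then show ?case by (metis lim_imp_Liminf sequentially_bot)
  qed
  have moment: "(\<integral>\<^sup>+w. ennreal ((h n w)^4) \<partial>P) \<le> ennreal (3 * (\<integral>w. (h n w)\<^sup>2 \<partial>P)\<^sup>2)" for n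
  proof -
    obtain S a where S: "finite S" "h n = (\<lambda>w. \<Sum>s\<in>S. a s * \<epsilon> s w)"
      using h(1)[of n] by (auto simp: finite_combinations_def)
    have rv: "gaussian_rv P (h n)" using gauss S by (simp add: gaussian_process_def)
    have "integrable P (\<epsilon> s)" for s
      using section_L2 by (rule L2_imp_integrable)
    then have mean: "(\<integral>w. h n w \<partial>P) = 0"
      using S by (simp add: centered)
    note mom = gaussian_rv_moments[OF prob_space_axioms rv mean]
    have "(\<integral>\<^sup>+w. ennreal ((h n w)^4) \<partial>P) = ennreal (\<integral>w. (h n w)^4 \<partial>P)"
      using mom(3) by (intro nn_integral_eq_integral) auto
    also have "\<dots> \<le> ennreal (3 * (\<integral>w. (h n w)\<^sup>2 \<partial>P)\<^sup>2)"
      using mom(4) by (rule ennreal_leI)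
    finally show ?thesis .
  qed
  have "(\<integral>\<^sup>+w. ennreal ((Z w)^4) \<partial>P) = (\<integral>\<^sup>+w. liminf (\<lambda>n. ennreal ((h (r n) w)^4)) \<partial>P)"
    by (rule nn_integral_cong_AE[OF lim])
  also have "\<dots> \<le> liminf (\<lambda>n. \<integral>\<^sup>+w. ennreal ((h (r n) w)^4) \<partial>P)"
    by (rule nn_integral_liminf) measurable
  also have "\<dots> \<le> liminf (\<lambda>n. ennreal (3 * (\<integral>w. (h (r n) w)\<^sup>2 \<partial>P)\<^sup>2))"
    using moment by (intro Liminf_mono always_eventually) auto
  also have "(\<lambda>n. ennreal (3 * (\<integral>w. (h (r n) w)\<^sup>2 \<partial>P)\<^sup>2)) \<longlonglongrightarrow> ennreal (3 * (\<integral>w. (Z w)\<^sup>2 \<partial>P)\<^sup>2)"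
    using LIMSEQ_subseq_LIMSEQ[OF second r(1)] by (intro tendsto_intros tendsto_ennrealI) (simp add: o_def)
  then have "liminf (\<lambda>n. ennreal (3 * (\<integral>w. (h (r n) w)\<^sup>2 \<partial>P)\<^sup>2)) = ennreal (3 * (\<integral>w. (Z w)\<^sup>2 \<partial>P)\<^sup>2)"
    by (intro lim_imp_Liminf) auto
  finally show ?thesis by (simp add: Z_def)
qed

text \<open>Each \<open>e j\<close> is an eigenvector of the covariance operator with eigenvalue
  \<open>lam j powr a\<close>, so orthonormality of the basis becomes uncorrelatedness of the
  coordinates.\<close>

lemma covariance_basis_coefficients:
  assumes centered: "\<And>s. (\<integral>w. \<epsilon> s w \<partial>P) = 0"
    and basis: "l2_orthonormal_basis \<nu> e"
    and cov: "\<And>g. g \<in> L2 \<nu> \<Longrightarrow> is_power_image \<nu> e lam a g (covariance_op \<nu> (covariance_fun P \<epsilon>) g)"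
  shows "(\<integral>w. integrated (e i) w * integrated (e j) w \<partial>P) = (if i = j then lam i powr a else 0)"
proof -
  let ?C = "covariance_op \<nu> (covariance_fun P \<epsilon>)"
  have e: "\<And>i. e i \<in> L2 \<nu>" and on: "\<And>i j. l2_inner \<nu> (e i) (e j) = (if i = j then 1 else 0)"
    using basis by (auto simp: l2_orthonormal_basis_def)
  have [measurable]: "\<And>i. e i \<in> borel_measurable \<nu>" using e by (auto simp: L2_def)
  have [measurable]: "?C (e j) \<in> borel_measurable \<nu>"
    using cov[OF e[of j]] by (auto simp: is_power_image_def l2_sums_def L2_def)
  have "l2_inner \<nu> (e i) (?C (e j)) = (\<integral>s. lam j powr a * (e i s * e j s) \<partial>\<nu>)"
    unfolding l2_inner_def
    using power_image_basis[OF basis cov[OF e[of j]]]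
    by (intro integral_cong_AE) (auto simp: mult_ac)
  also have "\<dots> = lam j powr a * l2_inner \<nu> (e i) (e j)" by (simp add: l2_inner_def)
  finally show ?thesis
    unfolding covariance_integrated[OF centered e e] on by simp
qed

text \<open>The sum is almost surely the integral of the process against the single function
  \<open>g\<close>, so the bound for one integral applies; only the diagonal terms of its variance
  survive.\<close>

lemma fourth_moment_coefficients:
  assumes gauss: "gaussian_process P \<epsilon>" and centered: "\<And>s. (\<integral>w. \<epsilon> s w \<partial>P) = 0"
    and f: "\<And>i. f i \<in> L2 \<nu>"
    and cov: "\<And>i j. (\<integral>w. integrated (f i) w * integrated (f j) w \<partial>P) = (if i = j then u i else 0)"
    and F: "finite F"
  shows "(\<integral>\<^sup>+w. ennreal ((\<Sum>i\<in>F. c i * integrated (f i) w)^4) \<partial>P)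
    \<le> ennreal (3 * (\<Sum>i\<in>F. (c i)\<^sup>2 * u i)\<^sup>2)"
proof -
  define g where "g s = (\<Sum>i\<in>F. c i * f i s)" for s
  have g: "g \<in> L2 \<nu>" unfolding g_def[abs_def] by (rule L2_sum[OF f])
  note [measurable] = integrated_measurable[OF f] integrated_measurable[OF g]
  have ae: "AE w in P. integrated g w = (\<Sum>i\<in>F. c i * integrated (f i) w)"
    unfolding g_def by (rule AE_integrated_sum[OF f])
  have int: "integrable P (\<lambda>w. integrated (f i) w * integrated (f j) w)" for i j
    using integrated_L2[OF f] by (intro integrable_mult_of_squares) (auto simp: L2_def)
  have "(\<integral>w. (integrated g w)\<^sup>2 \<partial>P) = (\<integral>w. (\<Sum>i\<in>F. c i * integrated (f i) w)\<^sup>2 \<partial>P)"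
    using ae by (intro integral_cong_AE) auto
  also have "\<dots> = (\<integral>w. (\<Sum>i\<in>F. \<Sum>j\<in>F. c i * c j * (integrated (f i) w * integrated (f j) w)) \<partial>P)"
    by (simp add: power2_eq_square sum_product mult_ac)
  also have "\<dots> = (\<Sum>i\<in>F. \<Sum>j\<in>F. c i * c j * (if i = j then u i else 0))"
    using int by (simp add: Bochner_Integration.integral_sum cov)
  also have "\<dots> = (\<Sum>i\<in>F. (c i)\<^sup>2 * u i)"
    using F by (simp add: if_distrib[of "\<lambda>x. _ * x"] power2_eq_square cong: if_cong)
  finally have second: "(\<integral>w. (integrated g w)\<^sup>2 \<partial>P) = (\<Sum>i\<in>F. (c i)\<^sup>2 * u i)" .
  have "(\<integral>\<^sup>+w. ennreal ((\<Sum>i\<in>F. c i * integrated (f i) w)^4) \<partial>P) =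
      (\<integral>\<^sup>+w. ennreal ((integrated g w)^4) \<partial>P)"
    using ae by (intro nn_integral_cong_AE) auto
  with fourth_moment_integrated[OF gauss centered g] show ?thesis by (simp add: second)
qed

end

section \<open>Limits of the estimator\<close>

theorem proposition1:
  fixes \<nu> :: "'x::metric_space measure"
    and P :: "'w measure"
    and \<epsilon> :: "'x \<Rightarrow> 'w \<Rightarrow> real"
    and D\<^sub>A D\<^sub>S :: "('x \<Rightarrow> real) set"
    and A A\<^sub>S :: "('x \<Rightarrow> real) \<Rightarrow> 'x \<Rightarrow> real"
    and e :: "nat \<Rightarrow> 'x \<Rightarrow> real"
    and lam lam\<^sub>S :: "nat \<Rightarrow> real"
    and \<eta> c C c\<^sub>S C\<^sub>S \<alpha> \<gamma> p \<beta> :: real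
    and X :: "'x \<Rightarrow> real"
    and Y :: "'w \<Rightarrow> nat \<Rightarrow> real"
  assumes space: "connected (UNIV :: 'x set)" "compact (UNIV :: 'x set)" "infinite (UNIV :: 'x set)"
    and \<nu>: "sets \<nu> = sets borel" "finite_measure \<nu>"
      "\<And>U. open U \<Longrightarrow> U \<noteq> {} \<Longrightarrow> 0 < emeasure \<nu> U"
    and P: "prob_space P" "complete_measure P"
    and \<epsilon>_measurable: "(\<lambda>(s, w). \<epsilon> s w) \<in> borel_measurable (\<nu> \<Otimes>\<^sub>M P)"
    and \<epsilon>_square_integrable: "integrable (\<nu> \<Otimes>\<^sub>M P) (\<lambda>(s, w). (\<epsilon> s w)\<^sup>2)"
    and \<epsilon>_gaussian: "gaussian_process P \<epsilon>"
    and \<epsilon>_centered: "\<And>s. (\<integral>w. \<epsilon> s w \<partial>P) = 0"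
    and cov_pd: "strictly_positive_definite (covariance_fun P \<epsilon>)"
    and A: "l2_operator \<nu> D\<^sub>A A" "D\<^sub>A \<subset> L2 \<nu>" "densely_defined \<nu> D\<^sub>A"
      "self_adjoint \<nu> D\<^sub>A A" "positive_operator \<nu> D\<^sub>A A" "has_compact_inverse \<nu> D\<^sub>A A"
    and basis: "l2_orthonormal_basis \<nu> e"
    and eigen: "\<And>j. e j \<in> D\<^sub>A \<and> l2_eq \<nu> (A (e j)) (\<lambda>s. lam j * e j s)"
    and lam: "\<And>j. 0 < lam j" "mono lam"
    and weyl: "0 < c" "0 < C" "0 < \<eta>"
      "\<And>j. c * real (Suc j) powr \<eta> \<le> lam j \<and> lam j \<le> C * real (Suc j) powr \<eta>"
    and AS: "l2_operator \<nu> D\<^sub>S A\<^sub>S" "diagonalized_by \<nu> D\<^sub>S A\<^sub>S e lam\<^sub>S" "\<And>j. 0 < lam\<^sub>S j"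
    and weylS: "0 < c\<^sub>S" "0 < C\<^sub>S"
      "\<And>j. c\<^sub>S * real (Suc j) powr \<eta> \<le> lam\<^sub>S j \<and> lam\<^sub>S j \<le> C\<^sub>S * real (Suc j) powr \<eta>"
    and params: "0 < \<alpha>" "0 < p"
    and cov_op: "\<And>w. w \<in> L2 \<nu> \<Longrightarrow>
      is_power_image \<nu> e lam (-\<alpha>) w (covariance_op \<nu> (covariance_fun P \<epsilon>) w)"
    and X: "X \<in> Hdot \<nu> e lam p" "\<And>q. p < q \<Longrightarrow> X \<notin> Hdot \<nu> e lam q"
    and Y: "\<And>w i. Y w i = \<beta> * power_coeff \<nu> e lam\<^sub>S \<gamma> X i + l2_coeff \<nu> e (\<lambda>s. \<epsilon> s w) i"
  shows "(p < \<alpha> \<and> \<gamma> = 0 \<longrightarrow> (AE w in P. mle lam \<alpha> (l2_coeff \<nu> e X) (Y w) \<longlonglongrightarrow> \<beta>)) \<and>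
    (p < \<alpha> \<and> \<gamma> < 0 \<longrightarrow> (AE w in P. mle lam \<alpha> (l2_coeff \<nu> e X) (Y w) \<longlonglongrightarrow> 0)) \<and>
    (p < \<alpha> \<and> \<gamma> > 0 \<or> p \<ge> \<alpha> \<and> \<gamma> > p - \<alpha> \<longrightarrow>
      (\<beta> > 0 \<longrightarrow> (AE w in P. filterlim (mle lam \<alpha> (l2_coeff \<nu> e X) (Y w)) at_top sequentially)) \<and>
      (\<beta> < 0 \<longrightarrow> (AE w in P. filterlim (mle lam \<alpha> (l2_coeff \<nu> e X) (Y w)) at_bot sequentially))) \<and>
    (p \<ge> \<alpha> \<and> \<gamma> \<le> p - \<alpha> \<longrightarrow>
      X \<in> Hdot \<nu> e lam \<alpha> \<and> 0 < cm_norm lam \<alpha> (l2_coeff \<nu> e X) \<and> cm_summable lam \<alpha> (power_coeff \<nu> e lam\<^sub>S \<gamma> X) (l2_coeff \<nu> e X) \<and>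
      (AE w in P. cm_summable lam \<alpha> (Y w) (l2_coeff \<nu> e X)) \<and>
      (AE w in P. mle lam \<alpha> (l2_coeff \<nu> e X) (Y w) \<longlonglongrightarrow>
         cm_inner lam \<alpha> (Y w) (l2_coeff \<nu> e X) / (cm_norm lam \<alpha> (l2_coeff \<nu> e X))\<^sup>2) \<and>
      integrable P (\<lambda>w. cm_inner lam \<alpha> (Y w) (l2_coeff \<nu> e X) / (cm_norm lam \<alpha> (l2_coeff \<nu> e X))\<^sup>2) \<and>
      (\<integral>w. cm_inner lam \<alpha> (Y w) (l2_coeff \<nu> e X) / (cm_norm lam \<alpha> (l2_coeff \<nu> e X))\<^sup>2 \<partial>P) =
        \<beta> * cm_inner lam \<alpha> (power_coeff \<nu> e lam\<^sub>S \<gamma> X) (l2_coeff \<nu> e X) / (cm_norm lam \<alpha> (l2_coeff \<nu> e X))\<^sup>2)"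
proof -

  \<comment> \<open>Coordinates, weights and the decomposition of the estimator\<close>
  interpret nu: finite_measure \<nu> by (rule \<nu>(2))
  interpret prob_space P by (rule P(1))
  have space_nu: "space \<nu> = UNIV" using sets_eq_imp_space_eq[OF \<nu>(1)] by simp
  have centered: "(\<integral>w. \<epsilon> s w \<partial>P) = 0" for s by (rule \<epsilon>_centered)
  have section_L2: "\<epsilon> s \<in> L2 P" for s
  proof (rule gaussian_rv_moments(2)[OF P(1) _ centered])
    show "gaussian_rv P (\<epsilon> s)"
      using \<epsilon>_gaussian[unfolded gaussian_process_def, rule_format, of "{s}" "\<lambda>_. 1"] by simp
  qed
  interpret square_integrable_process P \<nu> \<epsilon>
    by unfold_locales (fact \<epsilon>_measurable \<epsilon>_square_integrable section_L2)+
  have e: "e i \<in> L2 \<nu>" for i using basis by (simp add: l2_orthonormal_basis_def)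
  define x where "x = l2_coeff \<nu> e X"
  define \<xi> where "\<xi> i = integrated (e i)" for i
  have [measurable]: "\<xi> i \<in> borel_measurable P" for i
    unfolding \<xi>_def using e by (rule integrated_measurable)
  define wt where "wt i = lam i powr \<alpha> * (x i)\<^sup>2" for i
  define s where "s i = lam\<^sub>S i powr \<gamma>" for i
  have wt: "0 \<le> wt i" and s: "0 < s i" for i using AS(3)[of i] by (auto simp: wt_def s_def)
  have Yi: "Y w i = \<beta> * (s i * x i) + \<xi> i w" for w i
    by (simp add: Y power_coeff_def s_def x_def \<xi>_def l2_coeff_def)
  define Q B where "Q n = (\<Sum>i<n. wt i)" and "B n = (\<Sum>i<n. wt i * s i)" for n
  define N where "N w n = (\<Sum>i<n. lam i powr \<alpha> * x i * \<xi> i w)" for w n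
  have Y_sum: "(\<Sum>i<n. lam i powr \<alpha> * Y w i * x i) = \<beta> * B n + N w n" for w n
    unfolding B_def N_def sum_distrib_left sum.distrib[symmetric]
    by (intro sum.cong) (auto simp: Yi wt_def power2_eq_square algebra_simps)
  have mle: "mle lam \<alpha> x (Y w) n = \<beta> * (B n / Q n) + N w n / Q n" if "Q n \<noteq> 0" for w n
    using mle_eq[of lam, OF lam(1), where n=n and \<alpha>=\<alpha> and x=x and y="Y w"] that
    unfolding Y_sum by (simp add: Q_def wt_def add_divide_distrib)

  \<comment> \<open>Thresholds for the summability of the weights\<close>
  have "c \<le> lam i" for i
  proof -
    have "c * 1 \<le> c * real (Suc i) powr \<eta>"
      using weyl(1,3) by (intro mult_left_mono ge_one_powr_ge_zero) auto
    with weyl(4)[of i] show ?thesis by simp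
  qed
  note lam_powr_le = summable_powr_le_exponent[of c lam, OF weyl(1) this]
  have X_summable: "summable (\<lambda>i. lam i powr q * (x i)\<^sup>2) \<longleftrightarrow> q \<le> p" for q
  proof
    assume "q \<le> p"
    moreover have "summable (\<lambda>i. lam i powr p * (x i)\<^sup>2)"
      using X(1) by (simp add: Hdot_def x_def)
    ultimately show "summable (\<lambda>i. lam i powr q * (x i)\<^sup>2)" by (rule lam_powr_le)
  next
    assume "summable (\<lambda>i. lam i powr q * (x i)\<^sup>2)"
    \<comment> \<open>Summability with an exponent above \<open>p\<close> would contradict the
      maximality of the smoothness of \<open>X\<close>.\<close>
    then show "q \<le> p" using X(1) X(2)[of q] by (force simp: Hdot_def x_def)
  qed
  have wt_summable: "summable wt \<longleftrightarrow> \<alpha> \<le> p"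
    using X_summable[of \<alpha>] by (simp add: wt_def[abs_def])

  have lam\<^sub>S_at_top: "filterlim lam\<^sub>S at_top sequentially"
  proof (rule filterlim_at_top_mono)
    show "filterlim (\<lambda>i. c\<^sub>S * real (Suc i) powr \<eta>) at_top sequentially"
    proof (rule filterlim_tendsto_pos_mult_at_top[OF tendsto_const weylS(1) powr_at_top_pos[OF weyl(3)]])
      show "filterlim (\<lambda>i. real (Suc i)) at_top sequentially"
        using filterlim_compose[OF filterlim_real_sequentially filterlim_Suc] .
    qed
  qed (use weylS(3) in auto)

  \<comment> \<open>Each constant pairs a bound on one spectrum with the opposite bound on the
    other, so that the common growth \<open>real (Suc i) powr \<eta>\<close> cancels.\<close>
  define k1 k2 where "k1 = c\<^sub>S / C" and "k2 = C\<^sub>S / c"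
  have k: "0 < k1" "0 < k2" using weyl(1,2) weylS(1,2) by (auto simp: k1_def k2_def)
  have comparable: "k1 * lam i \<le> lam\<^sub>S i" "lam\<^sub>S i \<le> k2 * lam i" for i
  proof -
    let ?r = "real (Suc i) powr \<eta>"
    have "k1 * lam i \<le> k1 * (C * ?r)" using weyl(4)[of i] k(1) by (intro mult_left_mono) auto
    also have "\<dots> \<le> lam\<^sub>S i" using weylS(3)[of i] weyl(2) by (simp add: k1_def)
    finally show "k1 * lam i \<le> lam\<^sub>S i" .
    have "lam\<^sub>S i \<le> k2 * (c * ?r)" using weylS(3)[of i] weyl(1) by (simp add: k2_def)
    also have "\<dots> \<le> k2 * lam i" using weyl(4)[of i] k(2) by (intro mult_left_mono) auto
    finally show "lam\<^sub>S i \<le> k2 * lam i" .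
  qed
  define k where "k = k1 powr \<gamma> + k2 powr \<gamma>"
  have s_le: "s i \<le> k * lam i powr \<gamma>" for i
    unfolding s_def k_def using lam(1) k comparable by (rule powr_comparable)
  \<comment> \<open>The two spectra exchange roles, so the comparison constants are inverted and
    swapped.\<close>
  define k' where "k' = (1 / k2) powr \<gamma> + (1 / k1) powr \<gamma>"
  have le_s: "lam i powr \<gamma> \<le> k' * s i" for i
    unfolding s_def k'_def using AS(3) k comparable[of i] lam(1)[of i]
    by (intro powr_comparable) (auto simp: field_simps)
  have wts_summable: "summable (\<lambda>i. wt i * s i) \<longleftrightarrow> \<gamma> \<le> p - \<alpha>"
  proof -
    have eq: "wt i * lam i powr \<gamma> = lam i powr (\<alpha> + \<gamma>) * (x i)\<^sup>2" for i
      by (simp add: wt_def powr_add mult_ac)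
    have le: "wt i * lam i powr \<gamma> \<le> k' * (wt i * s i)" "wt i * s i \<le> k * (wt i * lam i powr \<gamma>)" for i
      using mult_left_mono[OF le_s[of i] wt[of i]] mult_left_mono[OF s_le[of i] wt[of i]]
      by (simp_all only: mult.left_commute)
    have nonneg: "0 \<le> wt i * lam i powr \<gamma>" "0 \<le> wt i * s i" for i
      using wt[of i] s[of i] by simp_all
    have "summable (\<lambda>i. wt i * s i) \<longleftrightarrow> summable (\<lambda>i. wt i * lam i powr \<gamma>)"
      by (rule iffI) (erule summable_le_mult[OF nonneg(1) le(1)], erule summable_le_mult[OF nonneg(2) le(2)])
    also have "\<dots> \<longleftrightarrow> \<alpha> + \<gamma> \<le> p" unfolding eq by (rule X_summable)
    also have "\<dots> \<longleftrightarrow> \<gamma> \<le> p - \<alpha>" by linarith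
    finally show ?thesis .
  qed

  \<comment> \<open>Second and fourth moments of the noise\<close>
  have cov: "(\<integral>w. \<xi> i w * \<xi> j w \<partial>P) = (if i = j then lam i powr (-\<alpha>) else 0)" for i j
    unfolding \<xi>_def using centered basis cov_op by (rule covariance_basis_coefficients)
  have moment: "(\<integral>\<^sup>+w. ennreal ((\<Sum>i=m..<n. a i * \<xi> i w)^4) \<partial>P)
      \<le> ennreal (3 * (\<Sum>i=m..<n. (a i)\<^sup>2 * lam i powr (-\<alpha>))\<^sup>2)" for a :: "nat \<Rightarrow> real" and m n
    unfolding \<xi>_def using \<epsilon>_gaussian centered e cov[unfolded \<xi>_def]
    by (rule fourth_moment_coefficients) simp
  \<comment> \<open>The weights reappear as the variances of the noise terms. The factor
    \<open>b\<close> is 1 for the plain series and the reciprocal normaliser for Kronecker's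
    lemma.\<close>
  have noise_var: "(lam i powr \<alpha> * x i * b)\<^sup>2 * lam i powr (-\<alpha>) = wt i * b\<^sup>2" for i b
    using lam(1)[of i] by (simp add: wt_def powr_minus power2_eq_square field_simps)

  have Q_pos: "eventually (\<lambda>n. 0 < Q n) sequentially"
  proof -
    \<comment> \<open>If all coordinates vanished, \<open>X\<close> would lie in the smoothness
      space of order \<open>p + 1\<close>.\<close>
    have "\<exists>i. x i \<noteq> 0"
    proof (rule ccontr)
      assume "\<nexists>i. x i \<noteq> 0"
      then show False using X_summable[of "p + 1"] by simp
    qed
    then obtain i where "x i \<noteq> 0" ..
    then have "0 < wt i" using lam(1)[of i] by (simp add: wt_def)
    then have "0 < Q n" if "i < n" for n
      unfolding Q_def using wt that by (intro sum_pos2[of _ i]) auto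
    then show ?thesis by (auto simp: eventually_sequentially intro!: exI[of _ "Suc i"])
  qed
  have mle_ev: "eventually (\<lambda>n. \<beta> * (B n / Q n) + N w n / Q n = mle lam \<alpha> x (Y w) n) sequentially" for w
    using Q_pos by eventually_elim (simp add: mle)

  \<comment> \<open>Divergent total weight\<close>
  have noise_negligible: "AE w in P. (\<lambda>n. N w n / Q n) \<longlonglongrightarrow> 0" if "p < \<alpha>"
  proof -
    have Q: "filterlim (\<lambda>n. \<Sum>i<n. wt i) at_top sequentially"
      using wt wt_summable that by (intro sum_at_top_if_not_summable) auto
    define b where "b i = 1 / (1 + (\<Sum>j<Suc i. wt j))" for i
    have "AE w in P. summable (\<lambda>i. lam i powr \<alpha> * x i * b i * \<xi> i w)"
    proof (rule fourth_moment_series_summable)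
      show "(\<integral>\<^sup>+w. ennreal ((\<Sum>i=m..<n. lam i powr \<alpha> * x i * b i * \<xi> i w)^4) \<partial>P)
          \<le> ennreal (3 * (\<Sum>i=m..<n. wt i * (b i)\<^sup>2)\<^sup>2)" for m n
        using moment[of "\<lambda>i. lam i powr \<alpha> * x i * b i" m n] by (simp only: noise_var)
      show "summable (\<lambda>i. wt i * (b i)\<^sup>2)"
        using summable_normalised_squares[of wt, OF wt] by (simp add: b_def power_divide)
    qed (auto simp: wt finite_measure_axioms)
    then show ?thesis
    proof eventually_elim
      case (elim w)
      then have "summable (\<lambda>i. lam i powr \<alpha> * x i * \<xi> i w / (1 + (\<Sum>j<Suc i. wt j)))"
        by (simp add: b_def)
      from kronecker_normalised_sums[OF wt Q this] show ?case by (simp add: N_def Q_def)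
    qed
  qed

  \<comment> \<open>The averages \<open>B n / Q n\<close> inherit the limit of \<open>s\<close>; the
    limits 1 and 0 will give the cases \<gamma> = 0 and \<gamma> < 0.\<close>
  have undersmooth: "AE w in P. mle lam \<alpha> x (Y w) \<longlonglongrightarrow> \<beta> * l" if "p < \<alpha>" "s \<longlonglongrightarrow> l" for l
  proof -
    have "(\<lambda>n. B n / Q n) \<longlonglongrightarrow> l"
      unfolding B_def Q_def using wt that wt_summable
      by (intro weighted_average_tendsto sum_at_top_if_not_summable) auto
    then have BQ: "(\<lambda>n. \<beta> * (B n / Q n)) \<longlonglongrightarrow> \<beta> * l" by (intro tendsto_intros)
    show ?thesis
      using noise_negligible[OF that(1)]
    proof eventually_elim
      case (elim w)
      from Lim_transform_eventually[OF tendsto_add[OF BQ elim] mle_ev] show ?case by simp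
    qed
  qed

  \<comment> \<open>Finite total weight\<close>
  have noise_series: "AE w in P. summable (\<lambda>i. lam i powr \<alpha> * x i * \<xi> i w)"
    "integrable P (\<lambda>w. \<Sum>i. lam i powr \<alpha> * x i * \<xi> i w)"
    "(\<integral>w. (\<Sum>i. lam i powr \<alpha> * x i * \<xi> i w) \<partial>P) = 0" if "\<alpha> \<le> p"
  proof -
    have mom: "(\<integral>\<^sup>+w. ennreal ((\<Sum>i=m..<n. lam i powr \<alpha> * x i * \<xi> i w)^4) \<partial>P)
        \<le> ennreal (3 * (\<Sum>i=m..<n. wt i)\<^sup>2)" for m n
      using moment[of "\<lambda>i. lam i powr \<alpha> * x i" m n] noise_var[of _ 1] by simp
    have "summable wt" using that wt_summable by simp
    note series = fourth_moment_series[of P "\<lambda>i w. lam i powr \<alpha> * x i * \<xi> i w" wt 3,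
        OF finite_measure_axioms _ wt _ mom this]
    show "AE w in P. summable (\<lambda>i. lam i powr \<alpha> * x i * \<xi> i w)"
      "integrable P (\<lambda>w. \<Sum>i. lam i powr \<alpha> * x i * \<xi> i w)"
      using series(1,2) by auto
    have "integrable P (\<xi> i)" "(\<integral>w. \<xi> i w \<partial>P) = 0" for i
      unfolding \<xi>_def
      using L2_imp_integrable[OF integrated_L2[OF e]] expectation_integrated[OF centered e] by auto
    \<comment> \<open>All partial sums are centred, and convergence of the expectations transfers
      this to the series.\<close>
    then have "(\<integral>w. (\<Sum>i<n. lam i powr \<alpha> * x i * \<xi> i w) \<partial>P) = 0" for n by simp
    with series(3) have "(\<lambda>n. 0) \<longlonglongrightarrow> (\<integral>w. (\<Sum>i. lam i powr \<alpha> * x i * \<xi> i w) \<partial>P)" by simp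
    then show "(\<integral>w. (\<Sum>i. lam i powr \<alpha> * x i * \<xi> i w) \<partial>P) = 0"
      by (simp add: LIMSEQ_const_iff)
  qed
  have N_lim: "AE w in P. (\<lambda>n. N w n) \<longlonglongrightarrow> (\<Sum>i. lam i powr \<alpha> * x i * \<xi> i w)" if "\<alpha> \<le> p"
    using noise_series(1)[OF that] unfolding N_def by eventually_elim (rule summable_LIMSEQ)

  define q where "q = (\<Sum>i. wt i)"
  have q: "0 < q" "Q \<longlonglongrightarrow> q" if "\<alpha> \<le> p"
  proof -
    have sw: "summable wt" using that wt_summable by simp
    then show "Q \<longlonglongrightarrow> q" unfolding q_def Q_def[abs_def] by (rule summable_LIMSEQ)
    obtain n where "0 < Q n" using Q_pos by (auto simp: eventually_sequentially)
    also have "Q n \<le> q" unfolding Q_def q_def using sw wt by (intro sum_le_suminf) auto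
    finally show "0 < q" .
  qed

  \<comment> \<open>Divergence of the estimator\<close>
  have oversmooth: "filterlim (\<lambda>n. B n / Q n) at_top sequentially \<and>
      (AE w in P. \<exists>l. (\<lambda>n. N w n / Q n) \<longlonglongrightarrow> l)" if "p < \<alpha> \<and> \<gamma> > 0 \<or> p \<ge> \<alpha> \<and> \<gamma> > p - \<alpha>"
    using that
  proof (elim disjE conjE)
    assume a: "p < \<alpha>" "\<gamma> > 0"
    have "filterlim s at_top sequentially"
      unfolding s_def[abs_def] using a(2) lam\<^sub>S_at_top by (rule powr_at_top_pos)
    then have "filterlim (\<lambda>n. B n / Q n) at_top sequentially"
      unfolding B_def Q_def using wt s a wt_summable
      by (intro weighted_average_at_top sum_at_top_if_not_summable) (auto simp: less_imp_le)
    moreover have "AE w in P. \<exists>l. (\<lambda>n. N w n / Q n) \<longlonglongrightarrow> l"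
      using noise_negligible[OF a(1)] by eventually_elim blast
    ultimately show ?thesis ..
  next
    assume a: "\<alpha> \<le> p" "\<gamma> > p - \<alpha>"
    \<comment> \<open>Here the signal sum \<open>B\<close> diverges although its normaliser
      \<open>Q\<close> has the finite positive limit \<open>q\<close>.\<close>
    have "filterlim B at_top sequentially"
      unfolding B_def[abs_def] using wt s wts_summable a
      by (intro sum_at_top_if_not_summable) (auto simp: less_imp_le)
    moreover have "(\<lambda>n. inverse (Q n)) \<longlonglongrightarrow> inverse q" "0 < inverse q"
      using q[OF a(1)] by (auto intro!: tendsto_intros)
    ultimately have "filterlim (\<lambda>n. inverse (Q n) * B n) at_top sequentially"
      by (intro filterlim_tendsto_pos_mult_at_top)
    then have "filterlim (\<lambda>n. B n / Q n) at_top sequentially"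
      by (simp add: divide_inverse mult.commute)
    moreover have "AE w in P. \<exists>l. (\<lambda>n. N w n / Q n) \<longlonglongrightarrow> l"
      using N_lim[OF a(1)]
    proof eventually_elim
      case (elim w)
      from tendsto_divide[OF elim q(2)[OF a(1)]] q(1)[OF a(1)] show ?case by blast
    qed
    ultimately show ?thesis ..
  qed

  have case3: "(\<beta> > 0 \<longrightarrow> (AE w in P. filterlim (mle lam \<alpha> x (Y w)) at_top sequentially)) \<and>
      (\<beta> < 0 \<longrightarrow> (AE w in P. filterlim (mle lam \<alpha> x (Y w)) at_bot sequentially))"
    if "p < \<alpha> \<and> \<gamma> > 0 \<or> p \<ge> \<alpha> \<and> \<gamma> > p - \<alpha>"
  proof -
    \<comment> \<open>A finite noise limit, possibly random, cannot offset the signal, whose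
      divergence has the sign of \<beta>.\<close>
    note BQ = oversmooth[OF that, THEN conjunct1] and NQ = oversmooth[OF that, THEN conjunct2]
    have "AE w in P. filterlim (mle lam \<alpha> x (Y w)) at_top sequentially" if "\<beta> > 0"
      using NQ
    proof eventually_elim
      case (elim w)
      then obtain l where l: "(\<lambda>n. N w n / Q n) \<longlonglongrightarrow> l" ..
      have "filterlim (\<lambda>n. \<beta> * (B n / Q n)) at_top sequentially"
        by (rule filterlim_tendsto_pos_mult_at_top[OF tendsto_const that BQ])
      from filterlim_tendsto_add_at_top[OF l this]
      have "filterlim (\<lambda>n. \<beta> * (B n / Q n) + N w n / Q n) at_top sequentially"
        by (simp add: add.commute)
      then show ?case using filterlim_cong[OF refl refl mle_ev] by blast
    qed
    moreover have "AE w in P. filterlim (mle lam \<alpha> x (Y w)) at_bot sequentially" if "\<beta> < 0"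
      using NQ
    proof eventually_elim
      case (elim w)
      then obtain l where l: "(\<lambda>n. N w n / Q n) \<longlonglongrightarrow> l" ..
      have "filterlim (\<lambda>n. \<beta> * (B n / Q n)) at_bot sequentially"
        by (rule filterlim_tendsto_neg_mult_at_bot[OF tendsto_const that BQ])
      then have "filterlim (\<lambda>n. N w n / Q n + \<beta> * (B n / Q n)) at_bot sequentially"
        by (simp only: filterlim_tendsto_add_at_bot_iff[OF l])
      then have "filterlim (\<lambda>n. \<beta> * (B n / Q n) + N w n / Q n) at_bot sequentially"
        by (simp add: add.commute)
      then show ?case using filterlim_cong[OF refl refl mle_ev] by blast
    qed
    ultimately show ?thesis by blast
  qed

  \<comment> \<open>The finite limit and its expectation\<close>
  have case4: "X \<in> Hdot \<nu> e lam \<alpha> \<and> 0 < cm_norm lam \<alpha> x \<and>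
      cm_summable lam \<alpha> (power_coeff \<nu> e lam\<^sub>S \<gamma> X) x \<and>
      (AE w in P. cm_summable lam \<alpha> (Y w) x) \<and>
      (AE w in P. mle lam \<alpha> x (Y w) \<longlonglongrightarrow> cm_inner lam \<alpha> (Y w) x / (cm_norm lam \<alpha> x)\<^sup>2) \<and>
      integrable P (\<lambda>w. cm_inner lam \<alpha> (Y w) x / (cm_norm lam \<alpha> x)\<^sup>2) \<and>
      (\<integral>w. cm_inner lam \<alpha> (Y w) x / (cm_norm lam \<alpha> x)\<^sup>2 \<partial>P) =
        \<beta> * cm_inner lam \<alpha> (power_coeff \<nu> e lam\<^sub>S \<gamma> X) x / (cm_norm lam \<alpha> x)\<^sup>2"
    if a: "\<alpha> \<le> p" "\<gamma> \<le> p - \<alpha>"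
  proof -
    define b where "b = (\<Sum>i. wt i * s i)"
    define R where "R w = (\<Sum>i. lam i powr \<alpha> * x i * \<xi> i w)" for w
    have "summable (\<lambda>i. wt i * s i)" using a(2) wts_summable by simp
    then have B: "(\<lambda>i. wt i * s i) sums b" unfolding b_def by (rule summable_sums)
    then have B_lim: "B \<longlonglongrightarrow> b" by (simp add: B_def[abs_def] sums_def)
    have Bterm: "lam i powr \<alpha> * power_coeff \<nu> e lam\<^sub>S \<gamma> X i * x i = wt i * s i" for i
      by (simp add: power_coeff_def x_def wt_def s_def power2_eq_square)
    have "cm_inner lam \<alpha> x x = q"
      by (simp add: cm_inner_def q_def wt_def power2_eq_square mult.assoc)
    then have norm: "(cm_norm lam \<alpha> x)\<^sup>2 = q" "0 < cm_norm lam \<alpha> x"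
      using q(1)[OF a(1)] by (auto simp: cm_norm_def)
    have SX: "cm_summable lam \<alpha> (power_coeff \<nu> e lam\<^sub>S \<gamma> X) x"
        "cm_inner lam \<alpha> (power_coeff \<nu> e lam\<^sub>S \<gamma> X) x = b"
      using B by (auto simp: cm_summable_def cm_inner_def Bterm sums_iff)
    have Ysums: "AE w in P. (\<lambda>i. lam i powr \<alpha> * Y w i * x i) sums (\<beta> * b + R w)"
      using N_lim[OF a(1)]
    proof eventually_elim
      case (elim w)
      show ?case unfolding sums_def Y_sum R_def by (intro tendsto_intros B_lim elim)
    qed
    have inner: "AE w in P. cm_inner lam \<alpha> (Y w) x = \<beta> * b + R w"
      using Ysums by eventually_elim (simp add: cm_inner_def sums_iff)
    have lim: "AE w in P. mle lam \<alpha> x (Y w) \<longlonglongrightarrow> cm_inner lam \<alpha> (Y w) x / (cm_norm lam \<alpha> x)\<^sup>2"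
      using N_lim[OF a(1)] inner
    proof eventually_elim
      case (elim w)
      have "(\<lambda>n. \<beta> * (B n / Q n) + N w n / Q n) \<longlonglongrightarrow> \<beta> * (b / q) + R w / q"
        unfolding R_def using q[OF a(1)] by (intro tendsto_intros B_lim elim(1)) auto
      from Lim_transform_eventually[OF this mle_ev]
      have "mle lam \<alpha> x (Y w) \<longlonglongrightarrow> \<beta> * (b / q) + R w / q" .
      moreover have "\<beta> * (b / q) + R w / q = cm_inner lam \<alpha> (Y w) x / (cm_norm lam \<alpha> x)\<^sup>2"
        by (simp add: elim(2) norm add_divide_distrib)
      ultimately show ?case by simp
    qed
    \<comment> \<open>The pairing agrees with \<open>\<beta> * b + R w\<close> only almost surely.
      Transferring integrability and the integral along this equality requires the pairing itself to
      be measurable.\<close>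
    have [measurable]: "(\<lambda>w. Y w i) \<in> borel_measurable P" for i unfolding Yi by measurable
    have [measurable]: "(\<lambda>w. cm_inner lam \<alpha> (Y w) x) \<in> borel_measurable P"
      unfolding cm_inner_def by measurable
    have R: "integrable P R" "(\<integral>w. R w \<partial>P) = 0"
      unfolding R_def[abs_def] using noise_series(2,3)[OF a(1)] by auto
    have [measurable]: "R \<in> borel_measurable P" using R(1) by auto
    have int: "integrable P (\<lambda>w. cm_inner lam \<alpha> (Y w) x)"
      by (subst integrable_cong_AE[OF _ _ inner]) (use R in auto)
    have "(\<integral>w. cm_inner lam \<alpha> (Y w) x \<partial>P) = (\<integral>w. \<beta> * b + R w \<partial>P)"
      by (rule integral_cong_AE[OF _ _ inner]) auto
    also have "\<dots> = \<beta> * b" using R by (simp add: prob_space)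
    finally have E: "(\<integral>w. cm_inner lam \<alpha> (Y w) x \<partial>P) = \<beta> * b" .
    have "AE w in P. cm_summable lam \<alpha> (Y w) x"
      using Ysums by eventually_elim (auto simp: cm_summable_def sums_iff)
    moreover have "X \<in> Hdot \<nu> e lam \<alpha>"
      using X(1) X_summable[of \<alpha>] a(1) by (simp add: Hdot_def x_def)
    ultimately show ?thesis
      using norm(2) SX lim int E by simp
  qed

  \<comment> \<open>As \<open>0 powr 0\<close> is 0, the constant value 1 comes from the positivity
    of the eigenvalues.\<close>
  have "s \<longlonglongrightarrow> 1" if "\<gamma> = 0"
    unfolding s_def[abs_def] using that AS(3) by (simp add: less_imp_neq[symmetric])
  with undersmooth[of 1]
  have case1: "p < \<alpha> \<and> \<gamma> = 0 \<longrightarrow> (AE w in P. mle lam \<alpha> x (Y w) \<longlonglongrightarrow> \<beta>)" by simp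
  have "s \<longlonglongrightarrow> 0" if "\<gamma> < 0"
    unfolding s_def[abs_def] using that lam\<^sub>S_at_top by (rule tendsto_neg_powr)
  with undersmooth[of 0]
  have case2: "p < \<alpha> \<and> \<gamma> < 0 \<longrightarrow> (AE w in P. mle lam \<alpha> x (Y w) \<longlonglongrightarrow> 0)" by simp
  show ?thesis
    using case1 case2 case3 case4 unfolding x_def by blast
qed

end
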